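(* Let $k\ge 3$ and $s\geq k+3$ be integers, and let $\eta$ be a positive number. Then there exists a positive number $\gamma$ such that for all $A\ge 1$, $$\#\{\mathbf{a}\in(\mathbb{Z}\setminus\{0\})^s: |\mathbf{a}|\leq A,\ 0<\mathfrak{S}_{\mathbf{a}}<A^{-\eta}\}\ll A^{s-\gamma},$$ the implicit constant depending only on $k,s,\eta$.
   Context: $|\mathbf{a}|=\max_j|a_j|$. For $\mathbf{a}=(a_1,\dots,a_s)$ with non-zero integer entries and a prime $p$, $\chi_p(\mathbf{a})=\lim_{h\to\infty}p^{h(1-s)}\#\{1\le x_j\le p^h\ (1\le j\le s): a_1x_1^k+\dots+a_sx_s^k\equiv 0 \pmod{p^h}\}$ (these limits exist), and $\mathfrak{S}_{\mathbf{a}}=\prod_p\chi_p(\mathbf{a})$ (a convergent product). *)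

theory Defs
  imports "HOL-Analysis.Analysis" "HOL-Computational_Algebra.Primes"
begin

definition local_count :: "nat \<Rightarrow> nat \<Rightarrow> (nat \<Rightarrow> int) \<Rightarrow> nat \<Rightarrow> nat \<Rightarrow> nat" where
  "local_count k s a p h =
     card {x \<in> {..<s} \<rightarrow>\<^sub>E {1..int p ^ h}. (int p ^ h) dvd (\<Sum>j<s. a j * x j ^ k)}"

definition chi :: "nat \<Rightarrow> nat \<Rightarrow> (nat \<Rightarrow> int) \<Rightarrow> nat \<Rightarrow> real" where
  "chi k s a p = lim (\<lambda>h. real p powr (real h * (1 - real s)) * real (local_count k s a p h))"

definition sing_series :: "nat \<Rightarrow> nat \<Rightarrow> (nat \<Rightarrow> int) \<Rightarrow> real" where
  "sing_series k s a = lim (\<lambda>N. \<Prod>p\<in>{p. prime p \<and> p \<le> N}. chi k s a p)"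

end

theory Submission
  imports Defs "HOL-Number_Theory.Residues" "HOL-Computational_Algebra.Squarefree"
begin

text \<open>Hensel lifting makes the density of the solutions that are not divisible by \<open>p\<close> stable from
  level \<open>H\<close> on, where \<open>H\<close> is \<open>1\<close> plus twice the largest exponent of \<open>p\<close> in the numbers \<open>k a\<^sub>j\<close>.
  Hence \<open>\<chi>\<^sub>p\<close> is a finite count times an explicit factor, and if it is non-zero it is at least
  \<open>p\<^sup>-\<^sup>H\<^sup>(\<^sup>s\<^sup>-\<^sup>1\<^sup>)\<close>. If \<open>p\<close> is large and divides at most one coefficient, at least five coefficients are
  units, and square-root cancellation in \<open>\<Sum>\<^sub>x e(c x\<^sup>k / p)\<close> gives \<open>\<chi>\<^sub>p \<ge> 1 - O(p\<^sup>-\<^sup>3\<^sup>/\<^sup>2)\<close>. Multiplying up, a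
  non-zero singular series is bounded below by a negative power of the largest among the numbers
  \<open>gcd(a\<^sub>i, a\<^sub>j)\<close> (\<open>i \<noteq> j\<close>) and the square parts of the \<open>a\<^sub>j\<close>. If it is smaller than \<open>A\<^sup>-\<^sup>\<eta>\<close>, one of
  these numbers exceeds a positive power of \<open>A\<close>, up to a constant, which is rare since
  \<open>\<Sum> 1 / d\<^sup>2\<close> converges.\<close>

section \<open>Hensel lifting in one variable\<close>

text \<open>A single coefficient can carry primes whose product is as large as \<open>A\<close>, so
  the trivial bound \<open>p^-(H(s-1))\<close> is affordable only at small primes and at primes
  dividing two coefficients. At every other prime at most one coefficient is divisible by p. There
  it suffices to count the solutions with some \<open>x j\<close> prime to p at a unit coefficient:
  that count is stable from level 1 on, whatever power of p divides the remaining coefficient.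

  With t unit coefficients the relative error is O(p^(1-t/2)), and t = 5 is the first value for
  which this is summable over p. This is why s >= 6 is wanted, which follows from k >= 3 and s >=
  k+3.

  Square parts enter only through the level H at the bad primes: p may divide a gcd just once while
  a high power of p divides one coefficient, so gcds alone do not bound H. Both kinds of obstruction
  of size d have density about 1/d^2, since either d divides two coordinates or d^2 divides
  one.\<close>

lemma sum_int_interval_blocks:
  fixes g :: "int \<Rightarrow> 'a :: comm_monoid_add"
  assumes "q \<ge> 0"
  shows "(\<Sum>x\<in>{1..q * int m}. g x) = (\<Sum>t<m. \<Sum>x\<in>{1..q}. g (x + q * int t))"
proof (induction m)
  case (Suc m)
  obtain b where b: "b = q * int m" "b \<ge> 0"
    using assms by simp
  then have "q * int (Suc m) = b + q"
    by (simp add: algebra_simps)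
  then have "{1..q * int (Suc m)} = {1..q * int m} \<union> {q * int m + 1..q * int m + q}"
    using assms b(2) unfolding b(1)[symmetric] by auto
  moreover have "(\<Sum>x\<in>{q * int m + 1..q * int m + q}. g x) = (\<Sum>x\<in>{1..q}. g (x + q * int m))"
    by (rule sum.reindex_bij_witness[of _ "\<lambda>x. x + q * int m" "\<lambda>x. x - q * int m"]) auto
  ultimately show ?case
    using Suc by (subst sum.lessThan_Suc) (auto simp: sum.union_disjoint)
qed simp

lemma sum_int_interval_periodic:
  fixes g :: "int \<Rightarrow> 'a :: comm_semiring_1"
  assumes "q \<ge> 0" and per: "\<And>x y. [x = y] (mod q) \<Longrightarrow> g x = g y"
  shows "(\<Sum>x\<in>{1..q * int m}. g x) = of_nat m * (\<Sum>x\<in>{1..q}. g x)"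
proof -
  have "g (x + q * int t) = g x" for x t
    by (rule per) (simp add: cong_def)
  then show ?thesis
    using assms(1) by (simp add: sum_int_interval_blocks)
qed

lemma sum_PiE_insert:
  fixes g :: "('b \<Rightarrow> 'c) \<Rightarrow> 'a :: comm_monoid_add"
  assumes "j \<notin> I"
  shows "(\<Sum>x\<in>insert j I \<rightarrow>\<^sub>E S. g x) = (\<Sum>y\<in>I \<rightarrow>\<^sub>E S. \<Sum>v\<in>S. g (y(j := v)))"
proof -
  have "(\<Sum>x\<in>insert j I \<rightarrow>\<^sub>E S. g x) = (\<Sum>(v, y)\<in>S \<times> (I \<rightarrow>\<^sub>E S). g (y(j := v)))"
    unfolding PiE_insert_eq
    by (subst sum.reindex[OF inj_combinator[OF assms]]) (simp add: case_prod_unfold)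
  also have "\<dots> = (\<Sum>v\<in>S. \<Sum>y\<in>I \<rightarrow>\<^sub>E S. g (y(j := v)))"
    by (simp add: sum.cartesian_product)
  also have "\<dots> = (\<Sum>y\<in>I \<rightarrow>\<^sub>E S. \<Sum>v\<in>S. g (y(j := v)))"
    by (rule sum.swap)
  finally show ?thesis .
qed

text \<open>The large box is a union of \<open>m ^ card I\<close> translates of the period box. This
  is what carries counts from modulus \<open>p^H\<close> to modulus \<open>p^h\<close>.\<close>

lemma sum_box_periodic:
  fixes g :: "('b \<Rightarrow> int) \<Rightarrow> 'a :: comm_semiring_1"
  assumes "finite I" "q \<ge> 0"
    and per: "\<And>x y. (\<And>i. [x i = y i] (mod q)) \<Longrightarrow> g x = g y"
  shows "(\<Sum>x\<in>I \<rightarrow>\<^sub>E {1..q * int m}. g x) = of_nat m ^ card I * (\<Sum>x\<in>I \<rightarrow>\<^sub>E {1..q}. g x)"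
  using assms(1) per
proof (induction I arbitrary: g rule: finite_induct)
  case empty
  then show ?case by simp
next
  case (insert j I)
  have "(\<Sum>x\<in>insert j I \<rightarrow>\<^sub>E {1..q * int m}. g x)
      = (\<Sum>y\<in>I \<rightarrow>\<^sub>E {1..q * int m}. of_nat m * (\<Sum>v\<in>{1..q}. g (y(j := v))))"
    unfolding sum_PiE_insert[OF insert.hyps(2)]
    by (intro sum.cong refl sum_int_interval_periodic assms(2) insert.prems) (auto simp: fun_upd_def)
  also have "\<dots> = of_nat m ^ card I * (\<Sum>y\<in>I \<rightarrow>\<^sub>E {1..q}. of_nat m * (\<Sum>v\<in>{1..q}. g (y(j := v))))"
    by (intro insert.IH arg_cong2[of _ _ _ _ "(*)"] refl sum.cong insert.prems) (auto simp: fun_upd_def)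
  also have "\<dots> = of_nat m ^ card (insert j I) * (\<Sum>x\<in>insert j I \<rightarrow>\<^sub>E {1..q}. g x)"
    using insert.hyps by (simp add: sum_PiE_insert sum_distrib_left algebra_simps)
  finally show ?case .
qed

lemma card_filter_eq_sum:
  "finite A \<Longrightarrow> card {x \<in> A. P x} = (\<Sum>x\<in>A. of_bool (P x))"
  by (simp add: Collect_conj_eq Int_commute)

text \<open>This is the equation for the next p-adic digit \<open>t\<close> in a Hensel step: an
  invertible slope \<open>u\<close> determines the digit.\<close>

lemma card_linear_congruence:
  fixes z u :: int
  assumes "prime p" and "\<not> int p dvd u"
  shows "card {t \<in> {..<p}. int p dvd z + u * int t} = 1"
proof -
  have p: "prime (int p)" "p > 0" using assms prime_gt_0_nat by auto
  have cop: "coprime u (int p)"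
    using p assms by (metis coprime_commute prime_imp_coprime)
  then obtain v where v: "[u * v = 1] (mod int p)"
    using cong_solve_coprime_int by blast
  define t0 where "t0 = nat ((- z * v) mod int p)"
  have t0: "t0 < p" "int t0 = (- z * v) mod int p"
    using p(2) unfolding t0_def by (auto simp: nat_less_iff)
  have key: "int p dvd z + u * int t \<longleftrightarrow> t = t0" if "t < p" for t
  proof -
    have "[z + u * int t0 = z + u * (- z * v)] (mod int p)"
      unfolding t0(2) by (intro cong_add cong_mult cong_refl) (simp add: cong_def)
    also have "z + u * (- z * v) = z - z * (u * v)" by simp
    also have "[z - z * (u * v) = z - z * 1] (mod int p)"
      by (intro cong_diff cong_mult cong_refl v)
    finally have 0: "int p dvd z + u * int t0" by (simp add: cong_0_iff)
    have "int p dvd z + u * int t \<longleftrightarrow> int p dvd (z + u * int t) - (z + u * int t0)"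
      using 0 by (metis diff_add_cancel dvd_add_left_iff)
    also have "(z + u * int t) - (z + u * int t0) = u * (int t - int t0)"
      by (simp add: algebra_simps)
    also have "int p dvd u * (int t - int t0) \<longleftrightarrow> int p dvd int t - int t0"
      using cop by (simp add: coprime_commute coprime_dvd_mult_right_iff)
    also have "\<dots> \<longleftrightarrow> [int t = int t0] (mod int p)"
      by (simp add: cong_iff_dvd_diff)
    also have "\<dots> \<longleftrightarrow> t = t0"
      using that t0(1) by (simp add: cong_int_iff cong_less_modulus_unique_nat) (auto simp: cong_def)
    finally show ?thesis .
  qed
  have "{t \<in> {..<p}. int p dvd z + u * int t} = {t0}"
    using key t0(1) by auto
  then show ?thesis by simp
qed

text \<open>Taylor expansion to first order. Only the divisibility of the remainder by
  \<open>y\<close> squared matters later, so \<open>r\<close> is left unspecified.\<close>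

lemma power_add_cong_square:
  fixes x y :: int
  shows "\<exists>r. (x + y) ^ k = x ^ k + int k * x ^ (k - 1) * y + y\<^sup>2 * r"
proof (induction k)
  case 0
  show ?case by (intro exI[of _ 0]) simp
next
  case (Suc k)
  then obtain r where r: "(x + y) ^ k = x ^ k + int k * x ^ (k - 1) * y + y\<^sup>2 * r" by blast
  show ?case
  proof (intro exI[of _ "x * r + int k * x ^ (k - 1) + y * r"])
    have "x * x ^ (k - 1) = x ^ k" if "k > 0" using that by (cases k) auto
    then have *: "int k * (x * x ^ (k - 1)) = int k * x ^ k" by (cases "k = 0") auto
    have "(x + y) ^ Suc k = (x + y) * (x ^ k + int k * x ^ (k - 1) * y + y\<^sup>2 * r)"
      by (simp add: r)
    also have "\<dots> = x * x ^ k + int k * (x * x ^ (k - 1)) * y + y * x ^ k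
        + y\<^sup>2 * (x * r + int k * x ^ (k - 1) + y * r)"
      by (simp add: algebra_simps power2_eq_square)
    finally show "(x + y) ^ Suc k = x ^ Suc k + int (Suc k) * x ^ (Suc k - 1) * y
        + y\<^sup>2 * (x * r + int k * x ^ (k - 1) + y * r)"
      by (simp only: *) (simp add: algebra_simps)
  qed
qed

text \<open>At a unit \<open>v\<close> the derivative of \<open>a * v ^ k + n\<close> has p-adic
  valuation exactly \<open>e\<close>. Hence moving \<open>v\<close> by \<open>p^(m-e) * t\<close>
  changes the value by \<open>p^m\<close> times a unit times \<open>t\<close>, up to a remainder
  divisible by \<open>p^(2(m-e))\<close>. Solutions modulo \<open>p^m\<close> are therefore unions
  of classes modulo \<open>p^(m-e)\<close>, and of the p refinements of such a class exactly one
  solves the congruence modulo \<open>p^(m+1)\<close>. The condition \<open>h >= 2 * e + 1\<close>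
  says that 2(h-e) >= h+1, so the remainder vanishes at both levels.\<close>

lemma card_unit_power_solutions_Suc:
  fixes a n w :: int
  assumes p: "prime p" and ak: "a * int k = int p ^ e * w" and w: "\<not> int p dvd w"
    and h: "h \<ge> 2 * e + 1"
  shows "card {v \<in> {1..int p ^ Suc h}. \<not> int p dvd v \<and> int p ^ Suc h dvd a * v ^ k + n}
       = card {v \<in> {1..int p ^ h}. \<not> int p dvd v \<and> int p ^ h dvd a * v ^ k + n}"
proof -
  define S where "S m v \<longleftrightarrow> \<not> int p dvd v \<and> int p ^ m dvd a * v ^ k + n" for m v
  \<comment> \<open>The number of solution classes modulo \<open>p^(m-e)\<close>. This is the
    quantity that each Hensel step preserves; the full count is \<open>p^e\<close> times it at every
    level.\<close>
  define d where "d m = card {v \<in> {1..int p ^ (m - e)}. S m v}" for m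
  have p0: "p > 0" and pp: "prime (int p)" using p prime_gt_0_nat by auto
  have expand: "\<exists>r. a * (v + int p ^ (m - e) * t) ^ k + n
      = (a * v ^ k + n) + int p ^ m * (w * v ^ (k - 1) * t) + int p ^ (2 * (m - e)) * r"
    if "m \<ge> e" for m v t
  proof -
    obtain r where r: "(v + int p ^ (m - e) * t) ^ k
       = v ^ k + int k * v ^ (k - 1) * (int p ^ (m - e) * t) + (int p ^ (m - e) * t)\<^sup>2 * r"
      using power_add_cong_square by blast
    have "int p ^ m = int p ^ e * int p ^ (m - e)" using that by (simp flip: power_add)
    moreover have "a * (int k * v ^ (k - 1) * (int p ^ (m - e) * t))
        = (a * int k) * (v ^ (k - 1) * (int p ^ (m - e) * t))" by (simp add: algebra_simps)
    ultimately have "a * (int k * v ^ (k - 1) * (int p ^ (m - e) * t)) = int p ^ m * (w * v ^ (k - 1) * t)"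
      unfolding ak by (simp add: algebra_simps)
    moreover have "(int p ^ (m - e) * t)\<^sup>2 = int p ^ (2 * (m - e)) * t\<^sup>2"
      by (simp add: power_mult_distrib power_mult[symmetric] mult.commute)
    then have "a * ((int p ^ (m - e) * t)\<^sup>2 * r) = int p ^ (2 * (m - e)) * (a * t\<^sup>2 * r)"
      by (simp only: mult_ac)
    ultimately have "a * (v + int p ^ (m - e) * t) ^ k + n
      = (a * v ^ k + n) + int p ^ m * (w * v ^ (k - 1) * t) + int p ^ (2 * (m - e)) * (a * t\<^sup>2 * r)"
      unfolding r distrib_left by (simp only: add_ac)
    then show ?thesis by blast
  qed
  have pdvd: "int p dvd v + int p ^ (m - e) * t \<longleftrightarrow> int p dvd v" if "m > e" for m v t
  proof -
    have "int p dvd int p ^ (m - e) * t" using that by (simp add: dvd_power)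
    then show ?thesis by (simp add: dvd_add_left_iff)
  qed
  have c_eq_d: "card {v \<in> {1..int p ^ m}. S m v} = p ^ e * d m" if m: "m \<ge> 2 * e + 1" for m
  proof -
    have per: "S m v = S m v'" if "[v = v'] (mod int p ^ (m - e))" for v v'
    proof -
      from that obtain t where t: "v' = v + int p ^ (m - e) * t"
        by (metis cong_iff_lin)
      obtain r where r: "a * v' ^ k + n
         = (a * v ^ k + n) + int p ^ m * (w * v ^ (k - 1) * t) + int p ^ (2 * (m - e)) * r"
        using expand[of m v t] m unfolding t by auto
      have "int p ^ m dvd int p ^ m * (w * v ^ (k - 1) * t)" by simp
      moreover have "int p ^ m dvd int p ^ (2 * (m - e)) * r"
        using m by (intro dvd_mult2 le_imp_power_dvd) auto
      ultimately have "int p ^ m dvd a * v' ^ k + n \<longleftrightarrow> int p ^ m dvd a * v ^ k + n"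
        unfolding r by (simp add: dvd_add_left_iff)
      then show ?thesis using pdvd[of m v t] m unfolding S_def t by auto
    qed
    have "int p ^ m = int p ^ (m - e) * int (p ^ e)" using m by (simp flip: power_add)
    then have "card {v \<in> {1..int p ^ m}. S m v}
        = (\<Sum>v\<in>{1..int p ^ (m - e) * int (p ^ e)}. of_bool (S m v))"
      by (subst card_filter_eq_sum) auto
    also have "\<dots> = of_nat (p ^ e) * (\<Sum>v\<in>{1..int p ^ (m - e)}. of_bool (S m v))"
      by (intro sum_int_interval_periodic) (use per in auto)
    also have "\<dots> = p ^ e * d m" unfolding d_def by (subst card_filter_eq_sum) auto
    finally show ?thesis .
  qed
  \<comment> \<open>Each class modulo \<open>p^(h-e)\<close> is split into p classes modulo
    \<open>p^(h-e+1)\<close>, indexed by the digit \<open>t\<close>.\<close>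
  have "d (Suc h) = (\<Sum>v\<in>{1..int p ^ (h - e) * int p}. of_bool (S (Suc h) v))"
  proof -
    have "int p ^ (Suc h - e) = int p ^ (h - e) * int p" using h by (simp add: Suc_diff_le)
    then show ?thesis unfolding d_def by (subst card_filter_eq_sum) auto
  qed
  also have "\<dots> = (\<Sum>t<p. \<Sum>v\<in>{1..int p ^ (h - e)}. of_bool (S (Suc h) (v + int p ^ (h - e) * int t)))"
    by (intro sum_int_interval_blocks) auto
  also have "\<dots> = (\<Sum>v\<in>{1..int p ^ (h - e)}. \<Sum>t<p. of_bool (S (Suc h) (v + int p ^ (h - e) * int t)))"
    by (rule sum.swap)
  also have "\<dots> = (\<Sum>v\<in>{1..int p ^ (h - e)}. of_bool (S h v))"
  proof (rule sum.cong[OF refl])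
    fix v
    have *: "S (Suc h) (v + int p ^ (h - e) * int t) \<longleftrightarrow> \<not> int p dvd v \<and>
        int p ^ Suc h dvd (a * v ^ k + n) + int p ^ h * (w * v ^ (k - 1) * int t)" for t
    proof -
      obtain r where r: "a * (v + int p ^ (h - e) * int t) ^ k + n
         = (a * v ^ k + n) + int p ^ h * (w * v ^ (k - 1) * int t) + int p ^ (2 * (h - e)) * r"
        using expand[of h v "int t"] h by auto
      have "int p ^ Suc h dvd int p ^ (2 * (h - e)) * r"
        using h by (intro dvd_mult2 le_imp_power_dvd) auto
      then have "int p ^ Suc h dvd a * (v + int p ^ (h - e) * int t) ^ k + n \<longleftrightarrow>
         int p ^ Suc h dvd (a * v ^ k + n) + int p ^ h * (w * v ^ (k - 1) * int t)"
        unfolding r by (rule dvd_add_left_iff)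
      then show ?thesis using pdvd[of h v "int t"] h unfolding S_def by auto
    qed
    have eq: "(\<Sum>t<p. of_bool (S (Suc h) (v + int p ^ (h - e) * int t)))
       = card {t \<in> {..<p}. S (Suc h) (v + int p ^ (h - e) * int t)}"
      by (subst card_filter_eq_sum) auto
    show "(\<Sum>t<p. of_bool (S (Suc h) (v + int p ^ (h - e) * int t))) = (of_bool (S h v) :: nat)"
    proof (cases "S h v")
      case False
      have "\<not> S (Suc h) (v + int p ^ (h - e) * int t)" for t
      proof
        assume "S (Suc h) (v + int p ^ (h - e) * int t)"
        then have 1: "\<not> int p dvd v" and
          "int p ^ Suc h dvd (a * v ^ k + n) + int p ^ h * (w * v ^ (k - 1) * int t)"
          using * by auto
        then have "int p ^ h dvd (a * v ^ k + n) + int p ^ h * (w * v ^ (k - 1) * int t)"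
          by (meson dvd_power_le dvd_refl dvd_trans le_SucI order_refl le_imp_power_dvd)
        then have "int p ^ h dvd a * v ^ k + n" by (simp add: dvd_add_left_iff)
        with 1 False show False by (simp add: S_def)
      qed
      with False show ?thesis by simp
    next
      case True
      then obtain z where z: "a * v ^ k + n = int p ^ h * z" and v: "\<not> int p dvd v"
        unfolding S_def by (auto elim: dvdE)
      have "\<not> int p dvd w * v ^ (k - 1)"
        using w v pp by (metis prime_dvd_mult_iff prime_dvd_power)
      moreover have "S (Suc h) (v + int p ^ (h - e) * int t) \<longleftrightarrow> int p dvd z + w * v ^ (k - 1) * int t" for t
      proof -
        have "(a * v ^ k + n) + int p ^ h * (w * v ^ (k - 1) * int t)
          = int p ^ h * (z + w * v ^ (k - 1) * int t)"
          unfolding z by (simp add: algebra_simps)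
        then show ?thesis using * v p0 by (simp add: mult.commute)
      qed
      ultimately show ?thesis
        unfolding eq using True card_linear_congruence[OF p] by simp
    qed
  qed
  also have "\<dots> = d h" unfolding d_def by (subst card_filter_eq_sum) auto
  finally have "d (Suc h) = d h" .
  then show ?thesis
    using c_eq_d[of h] c_eq_d[of "Suc h"] h unfolding S_def by simp
qed

lemma card_unit_power_solutions_stable:
  fixes a n w :: int
  assumes "prime p" "a * int k = int p ^ e * w" "\<not> int p dvd w"
    and "H \<ge> 2 * e + 1" "h \<ge> H"
  shows "card {v \<in> {1..int p ^ h}. \<not> int p dvd v \<and> int p ^ h dvd a * v ^ k + n}
       = card {v \<in> {1..int p ^ H}. \<not> int p dvd v \<and> int p ^ H dvd a * v ^ k + n}"
  using assms(5)
proof (induction h rule: dec_induct)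
  case (step m)
  then show ?case
    using card_unit_power_solutions_Suc[OF assms(1-3), of m n] assms(4) by simp
qed simp

section \<open>Stable densities and the local factors\<close>

text \<open>The index set \<open>J\<close> is a parameter because two choices are needed: all
  indices for the exact value of \<open>chi\<close>, and the indices of unit coefficients for
  estimates that start from level 1.\<close>

definition unit_count :: "nat \<Rightarrow> nat \<Rightarrow> (nat \<Rightarrow> int) \<Rightarrow> nat \<Rightarrow> nat set \<Rightarrow> nat \<Rightarrow> nat" where
  "unit_count k s a p J h = card {x \<in> {..<s} \<rightarrow>\<^sub>E {1..int p ^ h}.
     (\<exists>j\<in>J. \<not> int p dvd x j) \<and> int p ^ h dvd (\<Sum>j<s. a j * x j ^ k)}"

lemma cong_diagonal_form:
  fixes a x y :: "'b \<Rightarrow> int"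
  assumes "\<And>i. i \<in> I \<Longrightarrow> [x i = y i] (mod q)"
  shows "[(\<Sum>i\<in>I. a i * x i ^ k) = (\<Sum>i\<in>I. a i * y i ^ k)] (mod q)"
  by (intro cong_sum cong_mult cong_pow cong_refl assms)

lemma cong_dvd_diagonal_form:
  fixes a x y :: "'b \<Rightarrow> int"
  assumes "\<And>i. i \<in> I \<Longrightarrow> [x i = y i] (mod q)"
  shows "q dvd (\<Sum>i\<in>I. a i * x i ^ k) \<longleftrightarrow> q dvd (\<Sum>i\<in>I. a i * y i ^ k)"
  using cong_diagonal_form[where a = a and k = k, OF assms] by (rule cong_dvd_iff)

lemma card_unit_coordinate_stable:
  fixes a :: "nat \<Rightarrow> int"
  assumes I: "finite I" "j \<in> I"
    and p: "prime p" "a j * int k = int p ^ e * w" "\<not> int p dvd w"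
    and H: "H \<ge> 2 * e + 1" "h \<ge> H"
    and Q: "\<And>x y. (\<And>i. i \<noteq> j \<Longrightarrow> [x i = y i] (mod int p)) \<Longrightarrow> Q x = Q y"
  shows "card {x \<in> I \<rightarrow>\<^sub>E {1..int p ^ h}.
             \<not> int p dvd x j \<and> Q x \<and> int p ^ h dvd (\<Sum>i\<in>I. a i * x i ^ k)}
       = (p ^ (h - H)) ^ (card I - 1) * card {x \<in> I \<rightarrow>\<^sub>E {1..int p ^ H}.
             \<not> int p dvd x j \<and> Q x \<and> int p ^ H dvd (\<Sum>i\<in>I. a i * x i ^ k)}"
proof -
  define J where "J = I - {j}"
  have J: "I = insert j J" "j \<notin> J" "finite J" using I by (auto simp: J_def)
  define C where "C m n = card {v \<in> {1..int p ^ m}. \<not> int p dvd v \<and> int p ^ m dvd a j * v ^ k + n}" for m n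
  define F where "F y = (\<Sum>i\<in>J. a i * y i ^ k)" for y
  have slice: "card {x \<in> I \<rightarrow>\<^sub>E {1..int p ^ m}.
             \<not> int p dvd x j \<and> Q x \<and> int p ^ m dvd (\<Sum>i\<in>I. a i * x i ^ k)}
       = (\<Sum>y\<in>J \<rightarrow>\<^sub>E {1..int p ^ m}. of_bool (Q y) * C m (F y))" for m
  proof -
    have "card {x \<in> I \<rightarrow>\<^sub>E {1..int p ^ m}.
             \<not> int p dvd x j \<and> Q x \<and> int p ^ m dvd (\<Sum>i\<in>I. a i * x i ^ k)}
       = (\<Sum>x\<in>insert j J \<rightarrow>\<^sub>E {1..int p ^ m}.
            of_bool (\<not> int p dvd x j \<and> Q x \<and> int p ^ m dvd (\<Sum>i\<in>insert j J. a i * x i ^ k)))"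
      unfolding J(1) using J(3) by (intro card_filter_eq_sum finite_PiE) auto
    also have "\<dots> = (\<Sum>y\<in>J \<rightarrow>\<^sub>E {1..int p ^ m}. of_bool (Q y) * C m (F y))"
      unfolding sum_PiE_insert[OF J(2)]
    proof (intro sum.cong refl)
      fix y
      have 1: "(\<Sum>i\<in>insert j J. a i * (y(j := v)) i ^ k) = a j * v ^ k + F y" for v
      proof -
        have "(\<Sum>i\<in>J. a i * (y(j := v)) i ^ k) = F y"
          unfolding F_def using J(2) by (intro sum.cong) auto
        then show ?thesis using J by simp
      qed
      have 2: "Q (y(j := v)) = Q y" for v
        by (rule Q) auto
      show "(\<Sum>v\<in>{1..int p ^ m}. of_bool (\<not> int p dvd (y(j := v)) j \<and> Q (y(j := v)) \<and>
           int p ^ m dvd (\<Sum>i\<in>insert j J. a i * (y(j := v)) i ^ k))) = of_bool (Q y) * C m (F y)"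
        unfolding 1 2 C_def by (subst card_filter_eq_sum) (auto simp: sum_distrib_left)
    qed
    finally show ?thesis .
  qed
  have CH: "C h n = C H n" for n
    unfolding C_def by (rule card_unit_power_solutions_stable[OF p H])
  have "(\<Sum>y\<in>J \<rightarrow>\<^sub>E {1..int p ^ h}. of_bool (Q y) * C h (F y))
      = (\<Sum>y\<in>J \<rightarrow>\<^sub>E {1..int p ^ H * int (p ^ (h - H))}. of_bool (Q y) * C H (F y))"
    using H(2) by (simp add: CH flip: power_add)
  also have "\<dots> = of_nat (p ^ (h - H)) ^ card J *
      (\<Sum>y\<in>J \<rightarrow>\<^sub>E {1..int p ^ H}. of_bool (Q y) * C H (F y))"
  proof (rule sum_box_periodic[OF J(3)])
    fix x y :: "nat \<Rightarrow> int"
    assume xy: "\<And>i. [x i = y i] (mod int p ^ H)"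
    have "int p dvd int p ^ H" using H(1) by (simp add: dvd_power)
    with xy have "Q x = Q y" by (intro Q) (meson cong_dvd_modulus)
    moreover have "C H (F x) = C H (F y)"
    proof -
      have "[F x = F y] (mod int p ^ H)" unfolding F_def by (rule cong_diagonal_form) (rule xy)
      then have "int p ^ H dvd a j * v ^ k + F x \<longleftrightarrow> int p ^ H dvd a j * v ^ k + F y" for v
        by (metis cong_add_lcancel cong_dvd_iff)
      then show ?thesis unfolding C_def by simp
    qed
    ultimately show "of_bool (Q x) * C H (F x) = of_bool (Q y) * C H (F y)" by simp
  qed auto
  finally show ?thesis
    unfolding slice using J by simp
qed

text \<open>Solutions are sorted by their unit coordinates: adding \<open>j\<close> to
  \<open>J\<close> contributes the solutions with \<open>x j\<close> a unit and all
  \<open>x i\<close>, \<open>i\<close> in \<open>J\<close>, divisible by p. Each such piece is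
  lifted in its own variable \<open>j\<close>, so the exponent \<open>e\<close> may vary with
  \<open>j\<close> as long as one level \<open>H\<close> serves all.\<close>

lemma unit_count_stable:
  assumes "J \<subseteq> {..<s}" and p: "prime p"
    and e: "\<And>j. j \<in> J \<Longrightarrow> \<exists>e w. a j * int k = int p ^ e * w \<and> \<not> int p dvd w \<and> 2 * e + 1 \<le> H"
    and h: "h \<ge> H"
  shows "unit_count k s a p J h = (p ^ (h - H)) ^ (s - 1) * unit_count k s a p J H"
proof -
  have "finite J" using assms(1) finite_subset by blast
  then show ?thesis using assms(1) e
  proof (induction J rule: finite_induct)
    case empty
    then show ?case by (simp add: unit_count_def)
  next
    case (insert j J)
    define Q where "Q x \<longleftrightarrow> (\<forall>i\<in>J. int p dvd x i)" for x :: "nat \<Rightarrow> int"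
    define T where "T m = card {x \<in> {..<s} \<rightarrow>\<^sub>E {1..int p ^ m}.
             \<not> int p dvd x j \<and> Q x \<and> int p ^ m dvd (\<Sum>i<s. a i * x i ^ k)}" for m
    have split: "unit_count k s a p (insert j J) m = unit_count k s a p J m + T m" for m
    proof -
      let ?S = "\<lambda>P. {x \<in> {..<s} \<rightarrow>\<^sub>E {1..int p ^ m}. P x \<and> int p ^ m dvd (\<Sum>i<s. a i * x i ^ k)}"
      have "?S (\<lambda>x. \<exists>j\<in>insert j J. \<not> int p dvd x j)
          = ?S (\<lambda>x. \<exists>j\<in>J. \<not> int p dvd x j) \<union> ?S (\<lambda>x. \<not> int p dvd x j \<and> Q x)"
        unfolding Q_def by blast
      moreover have "card (?S (\<lambda>x. \<exists>j\<in>J. \<not> int p dvd x j) \<union> ?S (\<lambda>x. \<not> int p dvd x j \<and> Q x))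
          = card (?S (\<lambda>x. \<exists>j\<in>J. \<not> int p dvd x j)) + card (?S (\<lambda>x. \<not> int p dvd x j \<and> Q x))"
        by (intro card_Un_disjoint finite_Collect_conjI) (auto simp: Q_def intro!: finite_PiE)
      ultimately show ?thesis unfolding unit_count_def T_def by simp
    qed
    obtain e w where ew: "a j * int k = int p ^ e * w" "\<not> int p dvd w" "2 * e + 1 \<le> H"
      using insert.prems(2)[of j] by auto
    have "T h = (p ^ (h - H)) ^ (card {..<s} - 1) * T H"
      unfolding T_def
    proof (rule card_unit_coordinate_stable[where a = a and Q = Q and j = j, OF _ _ p ew(1-3) h])
      fix x y :: "nat \<Rightarrow> int"
      assume "\<And>i. i \<noteq> j \<Longrightarrow> [x i = y i] (mod int p)"
      then have "int p dvd x i \<longleftrightarrow> int p dvd y i" if "i \<in> J" for i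
        using that insert.hyps(2) by (metis cong_dvd_iff)
      then show "Q x = Q y" by (simp add: Q_def)
    qed (use insert.prems in auto)
    moreover have "unit_count k s a p J h = (p ^ (h - H)) ^ (s - 1) * unit_count k s a p J H"
      using insert by auto
    ultimately show ?case by (simp add: split distrib_left)
  qed
qed

text \<open>Writing x = p y takes a factor \<open>p^k\<close> out of the form by homogeneity, which
  leaves a congruence modulo \<open>p^h\<close>. The new variables run up to
  \<open>p^(h+k-1)\<close>, that is through \<open>p^(k-1)\<close> full periods in each
  coordinate.\<close>

lemma card_nonprimitive_solutions:
  assumes p: "prime p" "k > 0"
  shows "card {x \<in> {..<s} \<rightarrow>\<^sub>E {1..int p ^ (h + k)}.
       (\<forall>j<s. int p dvd x j) \<and> int p ^ (h + k) dvd (\<Sum>j<s. a j * x j ^ k)}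
     = (p ^ (k - 1)) ^ s * local_count k s a p h"
proof -
  have p0: "int p > 0" using p prime_gt_0_nat by auto
  let ?A = "{x \<in> {..<s} \<rightarrow>\<^sub>E {1..int p ^ (h + k)}.
       (\<forall>j<s. int p dvd x j) \<and> int p ^ (h + k) dvd (\<Sum>j<s. a j * x j ^ k)}"
  let ?B = "{y \<in> {..<s} \<rightarrow>\<^sub>E {1..int p ^ h * int (p ^ (k - 1))}. int p ^ h dvd (\<Sum>j<s. a j * y j ^ k)}"
  have pw: "int p ^ (h + k) = int p * (int p ^ h * int (p ^ (k - 1)))"
    using p(2) by (cases k) (auto simp: power_add)
  have form: "(\<Sum>j<s. a j * (int p * y j) ^ k) = int p ^ k * (\<Sum>j<s. a j * y j ^ k)" for y
    by (simp add: sum_distrib_left power_mult_distrib mult_ac)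
  have "bij_betw (\<lambda>y. \<lambda>j\<in>{..<s}. int p * y j) ?B ?A"
  proof (rule bij_betw_byWitness[where f' = "\<lambda>x. \<lambda>j\<in>{..<s}. x j div int p"])
    show "\<forall>y\<in>?B. (\<lambda>j\<in>{..<s}. (\<lambda>j\<in>{..<s}. int p * y j) j div int p) = y"
      using p0 by (auto simp: PiE_def extensional_def restrict_def fun_eq_iff)
    show "\<forall>x\<in>?A. (\<lambda>j\<in>{..<s}. int p * (\<lambda>j\<in>{..<s}. x j div int p) j) = x"
    proof (intro ballI ext)
      fix x j assume "x \<in> ?A"
      then have 1: "x j = undefined" if "j \<notin> {..<s}" using that by (blast intro: PiE_arb)
      have 2: "int p * (x j div int p) = x j" if "j \<in> {..<s}"
        using that \<open>x \<in> ?A\<close> by (blast intro: dvd_mult_div_cancel)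
      show "(\<lambda>j\<in>{..<s}. int p * (\<lambda>j\<in>{..<s}. x j div int p) j) j = x j"
      proof (cases "j \<in> {..<s}")
        case True
        then show ?thesis using 2[OF True] by (simp only: restrict_apply if_True)
      next
        case False
        then show ?thesis using 1[OF False] by (simp only: restrict_apply if_False)
      qed
    qed
    show "(\<lambda>y. \<lambda>j\<in>{..<s}. int p * y j) ` ?B \<subseteq> ?A"
    proof (rule image_subsetI)
      fix y assume "y \<in> ?B"
      then have y: "y \<in> {..<s} \<rightarrow>\<^sub>E {1..int p ^ h * int (p ^ (k - 1))}"
        "int p ^ h dvd (\<Sum>j<s. a j * y j ^ k)" by simp_all
      have "(\<lambda>j\<in>{..<s}. int p * y j) \<in> {..<s} \<rightarrow>\<^sub>E {1..int p ^ (h + k)}"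
        unfolding restrict_PiE_iff
      proof
        fix j assume "j \<in> {..<s}"
        then have y': "y j \<in> {1..int p ^ h * int (p ^ (k - 1))}" using y(1) by (rule PiE_mem[rotated])
        then have "0 < int p * y j" using p0 by (intro mult_pos_pos) auto
        moreover have "int p * y j \<le> int p ^ (h + k)"
          unfolding pw by (rule mult_left_mono) (use y' in auto)
        ultimately show "int p * y j \<in> {1..int p ^ (h + k)}" by simp
      qed
      have "int p ^ (h + k) dvd (\<Sum>j<s. a j * (int p * y j) ^ k)"
        unfolding form using y(2) by (simp add: power_add mult.commute mult_dvd_mono)
      then have "int p ^ (h + k) dvd (\<Sum>j<s. a j * (\<lambda>j\<in>{..<s}. int p * y j) j ^ k)"
        by simp
      with \<open>(\<lambda>j\<in>{..<s}. int p * y j) \<in> _\<close> show "(\<lambda>j\<in>{..<s}. int p * y j) \<in> ?A"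
        by simp
    qed
    show "(\<lambda>x. \<lambda>j\<in>{..<s}. x j div int p) ` ?A \<subseteq> ?B"
    proof (rule image_subsetI)
      fix x assume "x \<in> ?A"
      then have x: "x \<in> {..<s} \<rightarrow>\<^sub>E {1..int p ^ (h + k)}" "\<forall>j<s. int p dvd x j"
        "int p ^ (h + k) dvd (\<Sum>j<s. a j * x j ^ k)" by simp_all
      have xd: "int p * (x j div int p) = x j" if "j < s" for j using x(2) that by simp
      have "(\<lambda>j\<in>{..<s}. x j div int p) \<in> {..<s} \<rightarrow>\<^sub>E {1..int p ^ h * int (p ^ (k - 1))}"
        unfolding restrict_PiE_iff
      proof
        fix j assume j: "j \<in> {..<s}"
        have "x j \<in> {1..int p ^ (h + k)}" using x(1) j by (rule PiE_mem)
        then have "1 \<le> int p * (x j div int p)"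
           "int p * (x j div int p) \<le> int p * (int p ^ h * int (p ^ (k - 1)))"
          unfolding xd[OF j[unfolded lessThan_iff]] pw[symmetric] by simp_all
        then have "0 < int p * (x j div int p)" "x j div int p \<le> int p ^ h * int (p ^ (k - 1))"
          using mult_le_cancel_left_pos[OF p0] by (linarith, blast)
        then have "0 < x j div int p" "x j div int p \<le> int p ^ h * int (p ^ (k - 1))"
          using zero_less_mult_pos[OF _ p0] by blast+
        then show "x j div int p \<in> {1..int p ^ h * int (p ^ (k - 1))}" by simp
      qed
      have "(\<Sum>j<s. a j * x j ^ k) = (\<Sum>j<s. a j * (int p * (x j div int p)) ^ k)"
        using xd by (intro sum.cong) auto
      also have "\<dots> = int p ^ k * (\<Sum>j<s. a j * (x j div int p) ^ k)" by (rule form)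
      finally have "int p ^ k * int p ^ h dvd int p ^ k * (\<Sum>j<s. a j * (x j div int p) ^ k)"
        using x(3) by (simp add: power_add mult.commute)
      then have "int p ^ h dvd (\<Sum>j<s. a j * (x j div int p) ^ k)" using p0 by simp
      then have "int p ^ h dvd (\<Sum>j<s. a j * (\<lambda>j\<in>{..<s}. x j div int p) j ^ k)" by simp
      with \<open>(\<lambda>j\<in>{..<s}. x j div int p) \<in> _\<close> show "(\<lambda>j\<in>{..<s}. x j div int p) \<in> ?B"
        by simp
    qed
  qed
  then have "card ?A = card ?B" by (simp add: bij_betw_same_card)
  also have "\<dots> = (\<Sum>y\<in>{..<s} \<rightarrow>\<^sub>E {1..int p ^ h * int (p ^ (k - 1))}.
       of_bool (int p ^ h dvd (\<Sum>j<s. a j * y j ^ k)))"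
    by (intro card_filter_eq_sum finite_PiE) auto
  also have "\<dots> = of_nat (p ^ (k - 1)) ^ card {..<s} * (\<Sum>y\<in>{..<s} \<rightarrow>\<^sub>E {1..int p ^ h}.
       of_bool (int p ^ h dvd (\<Sum>j<s. a j * y j ^ k)))"
    by (intro sum_box_periodic arg_cong[where f = of_bool] cong_dvd_diagonal_form) auto
  also have "\<dots> = (p ^ (k - 1)) ^ s * local_count k s a p h"
    unfolding local_count_def by (subst card_filter_eq_sum) (auto intro!: finite_PiE)
  finally show ?thesis .
qed

lemma local_count_recurrence:
  assumes p: "prime p" "k > 0"
  shows "local_count k s a p (h + k)
       = unit_count k s a p {..<s} (h + k) + (p ^ (k - 1)) ^ s * local_count k s a p h"
proof -
  let ?S = "\<lambda>P. {x \<in> {..<s} \<rightarrow>\<^sub>E {1..int p ^ (h + k)}. P x \<and> int p ^ (h + k) dvd (\<Sum>j<s. a j * x j ^ k)}"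
  have "local_count k s a p (h + k)
      = card (?S (\<lambda>x. \<exists>j\<in>{..<s}. \<not> int p dvd x j) \<union> ?S (\<lambda>x. \<forall>j<s. int p dvd x j))"
    unfolding local_count_def by (intro arg_cong[where f = card]) auto
  also have "\<dots> = card (?S (\<lambda>x. \<exists>j\<in>{..<s}. \<not> int p dvd x j)) + card (?S (\<lambda>x. \<forall>j<s. int p dvd x j))"
    by (intro card_Un_disjoint finite_Collect_conjI) (auto intro!: finite_PiE)
  finally show ?thesis
    unfolding card_nonprimitive_solutions[OF p] unit_count_def .
qed

text \<open>The limit is the fixed point of the affine map. The deviation from it is multiplied by
  \<open>\<rho>\<close> at each shift by \<open>k\<close>, so it decays geometrically along every
  residue class modulo \<open>k\<close>; \<open>B\<close> bounds the starting values of all these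
  classes at once.\<close>

lemma tendsto_of_affine_recurrence:
  fixes f :: "nat \<Rightarrow> real"
  assumes k: "k > 0" and \<rho>: "0 \<le> \<rho>" "\<rho> < 1"
    and rec: "\<And>h. h \<ge> h0 \<Longrightarrow> f (h + k) = u + \<rho> * f h"
  shows "f \<longlonglongrightarrow> u / (1 - \<rho>)"
proof -
  define L where "L = u / (1 - \<rho>)"
  have L: "L = u + \<rho> * L" using \<rho> by (simp add: L_def field_simps)
  define g where "g n = f (n + h0) - L" for n
  have g: "g (n + k) = \<rho> * g n" for n
    using rec[of "n + h0"] L by (simp add: g_def algebra_simps)
  have gr: "g (r + q * k) = \<rho> ^ q * g r" for r q
  proof (induction q)
    case (Suc q)
    then show ?case using g[of "r + q * k"] by (simp add: algebra_simps)
  qed simp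
  define B where "B = (\<Sum>r<k. \<bar>g r\<bar>)"
  have bound: "norm (g n) \<le> B * \<rho> ^ (n div k)" for n
  proof -
    have "g n = \<rho> ^ (n div k) * g (n mod k)"
      using gr[of "n mod k" "n div k"] by simp
    moreover have "\<bar>g (n mod k)\<bar> \<le> B"
      unfolding B_def using k by (intro member_le_sum) auto
    ultimately show ?thesis
      using \<rho> by (simp add: abs_mult mult.commute mult_right_mono)
  qed
  have "(\<lambda>n. \<rho> ^ (n div k)) \<longlonglongrightarrow> 0"
    by (rule filterlim_compose[OF LIMSEQ_power_zero filterlim_at_top_div_const_nat])
       (use \<rho> k in auto)
  then have "(\<lambda>n. B * \<rho> ^ (n div k)) \<longlonglongrightarrow> 0"
    by (rule tendsto_mult_right_zero)
  then have "g \<longlonglongrightarrow> 0"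
    by (rule Lim_null_comparison[rotated]) (use bound in auto)
  then have "(\<lambda>n. f (n + h0)) \<longlonglongrightarrow> L"
    unfolding g_def by (simp add: LIM_zero_iff)
  then show ?thesis unfolding L_def by (rule LIMSEQ_offset)
qed

text \<open>Solutions with all \<open>x\<^sub>j\<close> divisible by \<open>p\<close> rescale to solutions modulo \<open>p\<^sup>h\<close> instead of \<open>p\<^sup>h\<^sup>+\<^sup>k\<close>; the
  others have a stable density. So the normalised counts satisfy an affine recurrence with ratio
  \<open>p\<^sup>k\<^sup>-\<^sup>s\<close>, which yields both the existence and the value of the limit.\<close>

lemma chi_eq:
  assumes p: "prime p" "k > 0" and s: "k < s"
    and H: "\<And>j. j < s \<Longrightarrow> \<exists>e w. a j * int k = int p ^ e * w \<and> \<not> int p dvd w \<and> 2 * e + 1 \<le> H"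
  shows "chi k s a p = real (unit_count k s a p {..<s} H) / real p ^ (H * (s - 1)) / (1 - 1 / real p ^ (s - k))"
proof -
  define m where "m h = real (local_count k s a p h) / real p ^ (h * (s - 1))" for h
  define u where "u = real (unit_count k s a p {..<s} H) / real p ^ (H * (s - 1))"
  have p1: "real p > 1" using p prime_gt_1_nat by auto
  have m: "real p powr (real h * (1 - real s)) * real (local_count k s a p h) = m h" for h
  proof -
    have "real h * (1 - real s) = - real (h * (s - 1))"
      using s by (simp add: of_nat_diff algebra_simps)
    then have "real p powr (real h * (1 - real s)) = inverse (real p ^ (h * (s - 1)))"
      using p1 by (simp only: powr_minus) (simp add: powr_realpow del: of_nat_mult)
    then show ?thesis by (simp add: m_def divide_inverse)
  qed
  have "m \<longlonglongrightarrow> u / (1 - 1 / real p ^ (s - k))"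
  proof (rule tendsto_of_affine_recurrence)
    fix h assume "H \<le> h"
    then have "unit_count k s a p {..<s} (h + k) = (p ^ (h + k - H)) ^ (s - 1) * unit_count k s a p {..<s} H"
      using H by (intro unit_count_stable p) auto
    moreover have "real p ^ ((h + k) * (s - 1)) = (real p ^ (h + k - H)) ^ (s - 1) * real p ^ (H * (s - 1))"
    proof -
      have "(h + k) * (s - 1) = (h + k - H) * (s - 1) + H * (s - 1)"
        using \<open>H \<le> h\<close> by (simp flip: add_mult_distrib)
      then show ?thesis by (simp add: power_mult power_add)
    qed
    ultimately have 1: "real (unit_count k s a p {..<s} (h + k)) / real p ^ ((h + k) * (s - 1)) = u"
      using p1 unfolding u_def by simp
    \<comment> \<open>This splitting of the exponent is the source of the ratio:
      \<open>p^((k-1)s)\<close> lifted solutions against a normalisation that grows by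
      \<open>p^(k(s-1))\<close> leave \<open>p^(k-s)\<close>.\<close>
    have "real p ^ ((h + k) * (s - 1)) = (real p ^ (k - 1)) ^ s * real p ^ (s - k) * real p ^ (h * (s - 1))"
    proof -
      have "(h + k) * (s - 1) = (k - 1) * s + (s - k) + h * (s - 1)"
        using p(2) s by (cases k; cases s) (auto simp: algebra_simps)
      then show ?thesis by (simp add: power_mult power_add)
    qed
    then have 2: "real ((p ^ (k - 1)) ^ s * local_count k s a p h) / real p ^ ((h + k) * (s - 1))
        = 1 / real p ^ (s - k) * m h"
      unfolding m_def of_nat_mult of_nat_power using p1 by (simp only:) simp
    show "m (h + k) = u + 1 / real p ^ (s - k) * m h"
      unfolding 1[symmetric] 2[symmetric] unfolding m_def
      by (subst local_count_recurrence[OF p]) (simp add: add_divide_distrib)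
  qed (use p p1 s in \<open>auto simp: divide_simps one_less_power\<close>)
  then show ?thesis
    unfolding chi_def m u_def by (rule limI)
qed

section \<open>Power sums modulo a prime\<close>

definition add_char :: "nat \<Rightarrow> int \<Rightarrow> complex" where
  "add_char p n = cis (2 * pi * of_int n / of_nat p)"

lemma add_char_add: "add_char p (m + n) = add_char p m * add_char p n"
  by (simp add: add_char_def cis_mult ring_distribs add_divide_distrib)

lemma add_char_0 [simp]: "add_char p 0 = 1"
  by (simp add: add_char_def)

lemma add_char_minus: "add_char p (- n) = cnj (add_char p n)"
  by (simp add: add_char_def cis_cnj)

lemma add_char_diff: "add_char p (m - n) = add_char p m * cnj (add_char p n)"
  using add_char_add[of p m "- n"] by (simp add: add_char_minus)

lemma norm_add_char [simp]: "norm (add_char p n) = 1"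
  by (simp add: add_char_def)

lemma add_char_sum: "add_char p (\<Sum>i\<in>I. f i) = (\<Prod>i\<in>I. add_char p (f i))"
  by (induction I rule: infinite_finite_induct) (simp_all add: add_char_add)

lemma add_char_mult_modulus [simp]: "p > 0 \<Longrightarrow> add_char p (int p * n) = 1"
  using cis_multiple_2pi[of "of_int n"] by (simp add: add_char_def mult.assoc)

lemma add_char_cong:
  assumes "p > 0" "[m = n] (mod int p)"
  shows "add_char p m = add_char p n"
proof -
  obtain t where "n = m + int p * t" using assms(2) by (metis cong_iff_lin)
  then show ?thesis using assms(1) by (simp add: add_char_add)
qed

lemma add_char_eq_1_iff:
  assumes "p > 0"
  shows "add_char p n = 1 \<longleftrightarrow> int p dvd n"
proof
  assume "add_char p n = 1"
  then have "cos (2 * pi * of_int n / of_nat p) = 1"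
    by (simp add: add_char_def complex_eq_iff)
  then obtain m :: int where "2 * pi * of_int n / of_nat p = of_int m * 2 * pi"
    by (auto simp: cos_one_2pi_int)
  then have "real_of_int n = real_of_int (m * int p)" using assms by (simp add: field_simps)
  then show "int p dvd n" by (simp only: of_int_eq_iff) simp
qed (use assms in \<open>auto elim!: dvdE\<close>)

text \<open>The solution boxes use the representatives 1 to q, while \<open>mod\<close> produces
  those from 0 to q-1; the two systems differ by exchanging q and 0.\<close>

lemma sum_residues_cong:
  fixes g :: "int \<Rightarrow> 'a :: comm_monoid_add"
  assumes "q > 0" and per: "\<And>x y. [x = y] (mod q) \<Longrightarrow> g x = g y"
  shows "(\<Sum>x\<in>{1..q}. g x) = (\<Sum>x\<in>{0..<q}. g x)"
proof (rule sum.reindex_bij_witness[of _ "\<lambda>x. if x = 0 then q else x" "\<lambda>x. if x = q then 0 else x"])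
  fix x assume "x \<in> {1..q}"
  show "g (if x = q then 0 else x) = g x"
    by (auto intro: per simp: cong_def)
qed (use assms(1) in \<open>auto split: if_splits\<close>)

text \<open>Orthogonality: replacing \<open>b\<close> by \<open>b + 1\<close> permutes the residues
  and multiplies the sum by \<open>add_char p n\<close>, so the sum vanishes unless that value is
  1.\<close>

lemma sum_add_char:
  assumes p: "p > 0"
  shows "(\<Sum>b\<in>{1..int p}. add_char p (b * n)) = (if int p dvd n then of_nat p else 0)"
proof (cases "int p dvd n")
  case True
  then have "add_char p (b * n) = 1" for b using add_char_eq_1_iff[OF p] by simp
  with True show ?thesis by simp
next
  case False
  have "(\<Sum>b\<in>{1..int p}. add_char p (b * n)) = (\<Sum>b\<in>{1..int p}. add_char p ((b + 1) * n))"
  proof -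
    have per: "add_char p (x * n) = add_char p (y * n)" if "[x = y] (mod int p)" for x y
      using that by (intro add_char_cong p cong_mult cong_refl)
    have "(\<Sum>b\<in>{1..int p}. add_char p ((b + 1) * n)) = (\<Sum>b\<in>{0..<int p}. add_char p ((b + 1) * n))"
      using p by (intro sum_residues_cong per cong_add cong_refl) auto
    also have "\<dots> = (\<Sum>b\<in>{1..int p}. add_char p (b * n))"
      by (rule sum.reindex_bij_witness[of _ "\<lambda>x. x - 1" "\<lambda>x. x + 1"]) auto
    finally show ?thesis by simp
  qed
  also have "\<dots> = add_char p n * (\<Sum>b\<in>{1..int p}. add_char p (b * n))"
    by (simp add: sum_distrib_left ring_distribs add_char_add mult.commute)
  finally have "(1 - add_char p n) * (\<Sum>b\<in>{1..int p}. add_char p (b * n)) = 0"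
    by (simp add: algebra_simps)
  then show ?thesis using False add_char_eq_1_iff[OF p, of n] by simp
qed

definition power_sum :: "nat \<Rightarrow> nat \<Rightarrow> int \<Rightarrow> complex" where
  "power_sum p k c = (\<Sum>x\<in>{1..int p}. add_char p (c * x ^ k))"

lemma power_sum_cong:
  "p > 0 \<Longrightarrow> [c = d] (mod int p) \<Longrightarrow> power_sum p k c = power_sum p k d"
  unfolding power_sum_def by (intro sum.cong refl add_char_cong cong_mult cong_refl)

lemma card_power_residue_le:
  assumes "prime p" "k > 0"
  shows "card {x \<in> {1..int p}. [x ^ k = c] (mod int p)} \<le> k"
proof -
  have p: "p > 0" using assms prime_gt_0_nat by auto
  have "card {x \<in> {1..int p}. [x ^ k = c] (mod int p)}
      = card {x \<in> {0..<int p}. [x ^ k = c] (mod int p)}"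
  proof -
    have "(\<Sum>x\<in>{1..int p}. of_bool ([x ^ k = c] (mod int p)) :: nat)
        = (\<Sum>x\<in>{0..<int p}. of_bool ([x ^ k = c] (mod int p)))"
      by (intro sum_residues_cong arg_cong[where f = of_bool])
         (use p in \<open>auto intro: cong_trans cong_sym cong_pow\<close>)
    then show ?thesis by (subst (1 2) card_filter_eq_sum) auto
  qed
  also have "{x \<in> {0..<int p}. [x ^ k = c] (mod int p)}
      = int ` {x \<in> {..<p}. [x ^ k = nat (c mod int p)] (mod p)}"
  proof -
    have "[int x ^ k = c] (mod int p) \<longleftrightarrow> [x ^ k = nat (c mod int p)] (mod p)" for x
    proof -
      have "[x ^ k = nat (c mod int p)] (mod p) \<longleftrightarrow> [int (x ^ k) = int (nat (c mod int p))] (mod int p)"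
        by (simp only: cong_int_iff)
      also have "\<dots> \<longleftrightarrow> [int x ^ k = c] (mod int p)" using p by (simp add: cong_def)
      finally show ?thesis by simp
    qed
    moreover have "{0..<int p} = int ` {..<p}" by (simp add: image_int_atLeastLessThan lessThan_atLeast0)
    ultimately show ?thesis by auto
  qed
  also have "card (int ` {x \<in> {..<p}. [x ^ k = nat (c mod int p)] (mod p)}) \<le> k"
    using roots_mod_prime_bound[OF assms, of "nat (c mod int p)"] by (simp add: card_image)
  finally show ?thesis .
qed

text \<open>Expanding the square and summing over \<open>b\<close> first leaves p times the number
  of pairs with x^k congruent to y^k. For each x there are at most \<open>k\<close> such y.\<close>

lemma sum_norm_power_sum_sq_le:
  assumes "prime p" "k > 0"
  shows "(\<Sum>b\<in>{1..int p}. (norm (power_sum p k b))\<^sup>2) \<le> real k * real p ^ 2"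
proof -
  have p: "p > 0" using assms prime_gt_0_nat by auto
  have "complex_of_real (\<Sum>b\<in>{1..int p}. (norm (power_sum p k b))\<^sup>2)
      = (\<Sum>b\<in>{1..int p}. power_sum p k b * cnj (power_sum p k b))"
    by (simp flip: complex_norm_square)
  also have "\<dots> = (\<Sum>b\<in>{1..int p}. \<Sum>x\<in>{1..int p}. \<Sum>y\<in>{1..int p}. add_char p (b * (x ^ k - y ^ k)))"
    unfolding power_sum_def cnj_sum sum_product
    by (intro sum.cong refl) (simp add: right_diff_distrib add_char_diff)
  also have "\<dots> = (\<Sum>x\<in>{1..int p}. \<Sum>b\<in>{1..int p}. \<Sum>y\<in>{1..int p}. add_char p (b * (x ^ k - y ^ k)))"
    by (rule sum.swap)
  also have "\<dots> = (\<Sum>x\<in>{1..int p}. \<Sum>y\<in>{1..int p}. \<Sum>b\<in>{1..int p}. add_char p (b * (x ^ k - y ^ k)))"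
    by (intro sum.cong refl sum.swap)
  also have "\<dots> = (\<Sum>x\<in>{1..int p}. \<Sum>y\<in>{1..int p}. if int p dvd x ^ k - y ^ k then of_nat p else 0)"
    by (simp add: sum_add_char[OF p])
  also have "\<dots> = (\<Sum>x\<in>{1..int p}. of_nat p * of_nat (card {y \<in> {1..int p}. [y ^ k = x ^ k] (mod int p)}))"
  proof (intro sum.cong refl)
    fix x
    have "{y \<in> {1..int p}. int p dvd x ^ k - y ^ k} = {y \<in> {1..int p}. [y ^ k = x ^ k] (mod int p)}"
      by (simp add: cong_iff_dvd_diff dvd_diff_commute)
    then show "(\<Sum>y\<in>{1..int p}. if int p dvd x ^ k - y ^ k then of_nat p else 0)
      = complex_of_nat p * of_nat (card {y \<in> {1..int p}. [y ^ k = x ^ k] (mod int p)})"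
      by (subst sum.inter_filter[symmetric]) simp_all
  qed
  also have "\<dots> = complex_of_real (\<Sum>x\<in>{1..int p}. real p * real (card {y \<in> {1..int p}. [y ^ k = x ^ k] (mod int p)}))"
    by simp
  finally have "(\<Sum>b\<in>{1..int p}. (norm (power_sum p k b))\<^sup>2)
      = (\<Sum>x\<in>{1..int p}. real p * real (card {y \<in> {1..int p}. [y ^ k = x ^ k] (mod int p)}))"
    by (simp only: of_real_eq_iff)
  also have "\<dots> \<le> (\<Sum>x\<in>{1..int p}. real p * real k)"
    by (intro sum_mono mult_left_mono of_nat_mono card_power_residue_le assms) auto
  finally show ?thesis by (simp add: power2_eq_square mult_ac)
qed

text \<open>The factor \<open>z ^ k\<close> is absorbed by the substitution x -> z x, which permutes
  the residues modulo p.\<close>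

lemma power_sum_mult_power:
  assumes p: "prime p" and z: "\<not> int p dvd z"
  shows "power_sum p k (c * z ^ k) = power_sum p k c"
proof -
  have p0: "p > 0" using p prime_gt_0_nat by auto
  have cop: "coprime z (int p)"
    using p z by (metis coprime_commute prime_imp_coprime prime_nat_int_transfer)
  let ?R = "{0..<int p}"
  have per: "add_char p (c * x ^ k) = add_char p (c * y ^ k)" if "[x = y] (mod int p)" for x y
    by (intro add_char_cong p0 cong_mult cong_refl cong_pow that)
  have inj: "inj_on (\<lambda>x. (z * x) mod int p) ?R"
  proof (rule inj_onI)
    fix x y assume xy: "x \<in> ?R" "y \<in> ?R" "(z * x) mod int p = (z * y) mod int p"
    then have "[x = y] (mod int p)"
      using cop by (simp add: cong_mult_lcancel flip: cong_def)
    then show "x = y" using xy(1,2) by (simp add: cong_def)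
  qed
  have "(\<lambda>x. (z * x) mod int p) ` ?R = ?R"
    using inj p0 by (intro card_subset_eq card_image) auto
  with inj have bij: "bij_betw (\<lambda>x. (z * x) mod int p) ?R ?R" by (simp add: bij_betw_def)
  have "power_sum p k (c * z ^ k) = (\<Sum>x\<in>{1..int p}. add_char p (c * (z * x) ^ k))"
    unfolding power_sum_def by (simp add: power_mult_distrib mult_ac)
  also have "\<dots> = (\<Sum>x\<in>?R. add_char p (c * (z * x) ^ k))"
    using p0 by (intro sum_residues_cong per cong_mult cong_refl) auto
  also have "\<dots> = (\<Sum>x\<in>?R. add_char p (c * ((z * x) mod int p) ^ k))"
    by (intro sum.cong refl per) (simp add: cong_def)
  also have "\<dots> = (\<Sum>x\<in>?R. add_char p (c * x ^ k))"
    by (rule sum.reindex_bij_betw[OF bij])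
  also have "\<dots> = power_sum p k c"
    unfolding power_sum_def using p0 by (intro sum_residues_cong[symmetric] per) auto
  finally show ?thesis .
qed

text \<open>\<open>power_sum p k\<close> takes the value at \<open>c\<close> on the whole orbit \<open>c z\<^sup>k\<close>, hence on at least \<open>(p - 1) / k\<close>
  residues, and the second moment controls it.\<close>

lemma norm_power_sum_le:
  assumes p: "prime p" "k > 0" and c: "\<not> int p dvd c"
  shows "norm (power_sum p k c) \<le> 2 * real k * sqrt (real p)"
proof -
  have p0: "p > 0" and p2: "p \<ge> 2" using p prime_gt_0_nat prime_ge_2_nat by auto
  have pp: "prime (int p)" using p by simp
  let ?U = "{1..int p - 1}"
  let ?w = "\<lambda>b. (norm (power_sum p k b))\<^sup>2"
  have U: "\<not> int p dvd z" if "z \<in> ?U" for z using that zdvd_not_zless[of z "int p"] by auto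
  define \<phi> where "\<phi> z = (c * z ^ k) mod int p" for z
  have \<phi>: "\<phi> z \<in> ?U" if "z \<in> ?U" for z
  proof -
    have "\<not> int p dvd c * z ^ k" using U[OF that] c pp by (metis prime_dvd_mult_iff prime_dvd_power)
    then have "\<phi> z \<noteq> 0" by (simp add: \<phi>_def dvd_eq_mod_eq_0)
    moreover have "0 \<le> \<phi> z" "\<phi> z < int p" using p0 by (simp_all add: \<phi>_def)
    ultimately show ?thesis by auto
  qed
  have w\<phi>: "?w (\<phi> z) = ?w c" if "z \<in> ?U" for z
  proof -
    have "power_sum p k (\<phi> z) = power_sum p k (c * z ^ k)"
      by (rule power_sum_cong[OF p0]) (simp add: \<phi>_def cong_def)
    then show ?thesis using power_sum_mult_power[OF p(1) U[OF that]] by simp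
  qed
  \<comment> \<open>The orbit map \<open>\<phi>\<close> is at most k-to-one, because
    \<open>c\<close> cancels and z^k takes each value at most \<open>k\<close> times. Grouping by
    its values bounds p-1 copies of the wanted square by \<open>k\<close> times the second
    moment.\<close>
  have fib: "card {z \<in> ?U. \<phi> z = b} \<le> k" for b
  proof (cases "{z \<in> ?U. \<phi> z = b} = {}")
    case False
    then obtain z0 where z0: "z0 \<in> ?U" "\<phi> z0 = b" by auto
    have cop: "coprime c (int p)"
      using p c by (metis coprime_commute prime_imp_coprime prime_nat_int_transfer)
    have "{z \<in> ?U. \<phi> z = b} \<subseteq> {z \<in> {1..int p}. [z ^ k = z0 ^ k] (mod int p)}"
    proof safe
      fix z assume z: "z \<in> ?U" "b = \<phi> z"
      then have "[c * z ^ k = c * z0 ^ k] (mod int p)" using z0 by (simp add: \<phi>_def cong_def)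
      then show "[z ^ k = z0 ^ k] (mod int p)" using cop by (simp add: cong_mult_lcancel)
    qed auto
    moreover have "finite {z \<in> {1..int p}. [z ^ k = z0 ^ k] (mod int p)}"
      by (rule finite_subset[of _ "{1..int p}"]) auto
    ultimately have "card {z \<in> ?U. \<phi> z = b} \<le> card {z \<in> {1..int p}. [z ^ k = z0 ^ k] (mod int p)}"
      by (intro card_mono)
    then show ?thesis using card_power_residue_le[OF p, of "z0 ^ k"] by simp
  next
    case True
    then show ?thesis by (simp only: card.empty)
  qed
  have "(\<Sum>z\<in>?U. ?w (\<phi> z)) = (\<Sum>z\<in>?U. ?w c)"
    by (intro sum.cong refl w\<phi>)
  then have "real (p - 1) * ?w c = (\<Sum>z\<in>?U. ?w (\<phi> z))"
    using p2 by (simp add: of_nat_diff nat_diff_distrib)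
  also have "\<dots> = (\<Sum>b\<in>?U. \<Sum>z\<in>{z \<in> ?U. \<phi> z = b}. ?w (\<phi> z))"
    by (intro sum.group[symmetric]) (use \<phi> in auto)
  also have "\<dots> = (\<Sum>b\<in>?U. real (card {z \<in> ?U. \<phi> z = b}) * ?w b)"
    by (intro sum.cong refl) simp
  also have "\<dots> \<le> (\<Sum>b\<in>?U. real k * ?w b)"
    by (intro sum_mono mult_right_mono of_nat_mono fib) auto
  also have "\<dots> \<le> (\<Sum>b\<in>{1..int p}. real k * ?w b)"
    by (intro sum_mono2) auto
  also have "\<dots> \<le> real k * (real k * real p ^ 2)"
    unfolding sum_distrib_left[symmetric] by (intro mult_left_mono sum_norm_power_sum_sq_le p) auto
  finally have 1: "real (p - 1) * ?w c \<le> (real k)\<^sup>2 * (real p)\<^sup>2" by (simp add: power2_eq_square mult_ac)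
  \<comment> \<open>Trading p-1 for p costs a factor 2, which the constant \<open>2 * real k\<close>
    in the claim generously covers.\<close>
  have "real p * ?w c \<le> 2 * (real (p - 1) * ?w c)"
  proof -
    have "real p \<le> 2 * real (p - 1)" using p2 by (simp add: of_nat_diff)
    then have "real p * ?w c \<le> (2 * real (p - 1)) * ?w c" by (intro mult_right_mono) auto
    then show ?thesis by (simp add: mult_ac)
  qed
  with 1 have "real p * ?w c \<le> real p * (2 * (real k)\<^sup>2 * real p)"
    by (simp add: power2_eq_square mult_ac)
  then have "?w c \<le> 2 * (real k)\<^sup>2 * real p" using p0 by simp
  also have "\<dots> \<le> (2 * real k * sqrt (real p))\<^sup>2"
    by (simp add: power_mult_distrib)
  finally show ?thesis by (rule power2_le_imp_le) simp
qed

section \<open>Bounds for the local factors\<close>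

text \<open>The congruence is detected by averaging additive characters over \<open>b\<close>; for
  each \<open>b\<close> the sum over the box factors because the form is diagonal.\<close>

lemma local_count_1_eq_sum_power_sums:
  assumes p: "p > 0"
  shows "of_nat (p * local_count k s a p 1) = (\<Sum>b\<in>{1..int p}. \<Prod>j<s. power_sum p k (b * a j))"
proof -
  let ?X = "{..<s} \<rightarrow>\<^sub>E {1..int p}"
  have "complex_of_nat (p * local_count k s a p 1)
      = of_nat p * (\<Sum>x\<in>?X. of_bool (int p dvd (\<Sum>j<s. a j * x j ^ k)))"
    unfolding local_count_def by (subst card_filter_eq_sum) (auto intro!: finite_PiE)
  also have "\<dots> = (\<Sum>x\<in>?X. \<Sum>b\<in>{1..int p}. add_char p (b * (\<Sum>j<s. a j * x j ^ k)))"
  proof -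
    have "of_nat p * of_bool (int p dvd n) = (\<Sum>b\<in>{1..int p}. add_char p (b * n))" for n
      by (subst sum_add_char[OF p]) simp
    then show ?thesis unfolding sum_distrib_left[of "of_nat p"] by (simp only:)
  qed
  also have "\<dots> = (\<Sum>b\<in>{1..int p}. \<Sum>x\<in>?X. \<Prod>j<s. add_char p (b * a j * x j ^ k))"
    by (subst sum.swap) (simp add: sum_distrib_left add_char_sum mult_ac)
  also have "\<dots> = (\<Sum>b\<in>{1..int p}. \<Prod>j<s. power_sum p k (b * a j))"
    unfolding power_sum_def by (subst prod_sum_PiE) auto
  finally show ?thesis .
qed

lemma norm_power_sum_le_modulus: "norm (power_sum p k c) \<le> real p"
proof -
  have "norm (power_sum p k c) \<le> (\<Sum>x\<in>{1..int p}. norm (add_char p (c * x ^ k)))"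
    unfolding power_sum_def by (rule norm_sum)
  then show ?thesis by simp
qed

lemma power_sum_modulus [simp]:
  assumes "p > 0"
  shows "power_sum p k (int p * c) = of_nat p"
  using assms by (simp add: power_sum_def mult.assoc)

text \<open>The frequency \<open>b = p\<close> is the trivial one and supplies the main term. At
  every other frequency, coefficients in \<open>T\<close> give square-root cancellation and the
  remaining ones are bounded trivially by p. The p-1 frequencies are paid for by the factor p in
  front of the count.\<close>

lemma local_count_1_bound:
  assumes p: "prime p" "k > 0" and "s > 0"
    and T: "T = {j. j < s \<and> \<not> int p dvd a j}"
  shows "\<bar>real (local_count k s a p 1) - real p ^ (s - 1)\<bar>
       \<le> real p ^ (s - card T) * (2 * real k * sqrt (real p)) ^ card T"
proof -
  define B where "B = real p ^ (s - card T) * (2 * real k * sqrt (real p)) ^ card T"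
  have p0: "p > 0" using p prime_gt_0_nat by auto
  have B: "B \<ge> 0" by (simp add: B_def)
  let ?P = "\<lambda>b. \<Prod>j<s. power_sum p k (b * a j)"
  have bound: "norm (?P b) \<le> B" if b: "b \<in> {1..int p - 1}" for b
  proof -
    have "norm (?P b) = (\<Prod>j<s. norm (power_sum p k (b * a j)))"
      by (rule prod_norm[symmetric])
    also have "\<dots> \<le> (\<Prod>j<s. if j \<in> T then 2 * real k * sqrt (real p) else real p)"
    proof (intro prod_mono conjI)
      fix j assume "j \<in> {..<s}"
      have "\<not> int p dvd b" using b zdvd_not_zless[of b "int p"] by auto
      then have "\<not> int p dvd b * a j" if "j \<in> T"
        using that p T by (simp add: prime_dvd_mult_iff)
      then show "norm (power_sum p k (b * a j)) \<le> (if j \<in> T then 2 * real k * sqrt (real p) else real p)"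
        using norm_power_sum_le[OF p] norm_power_sum_le_modulus by auto
    qed auto
    also have "\<dots> = B"
    proof -
      have "{..<s} = T \<union> ({..<s} - T)" "T \<subseteq> {..<s}" "finite T" unfolding T by auto
      then have "(\<Prod>j<s. if j \<in> T then 2 * real k * sqrt (real p) else real p)
        = (\<Prod>j\<in>T. 2 * real k * sqrt (real p)) * (\<Prod>j\<in>{..<s} - T. real p)"
        by (subst \<open>{..<s} = T \<union> ({..<s} - T)\<close>, subst prod.union_disjoint) auto
      then show ?thesis
        using \<open>T \<subseteq> {..<s}\<close> \<open>finite T\<close> by (simp add: B_def card_Diff_subset)
    qed
    finally show ?thesis .
  qed
  have split: "(\<Sum>b\<in>{1..int p}. ?P b) = of_nat p ^ s + (\<Sum>b\<in>{1..int p - 1}. ?P b)"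
  proof -
    have "{1..int p} = insert (int p) {1..int p - 1}" using p0 by auto
    then show ?thesis using p0 by (simp add: mult.assoc)
  qed
  have "complex_of_real (real p * (real (local_count k s a p 1) - real p ^ (s - 1)))
      = of_nat (p * local_count k s a p 1) - of_nat p ^ s"
    using \<open>s > 0\<close> by (cases s) (simp_all add: algebra_simps)
  also have "\<dots> = (\<Sum>b\<in>{1..int p - 1}. ?P b)"
    unfolding local_count_1_eq_sum_power_sums[OF p0] split by simp
  finally have "\<bar>real p * (real (local_count k s a p 1) - real p ^ (s - 1))\<bar>
      = norm (\<Sum>b\<in>{1..int p - 1}. ?P b)"
    by (metis norm_of_real real_norm_def)
  also have "\<dots> \<le> (\<Sum>b\<in>{1..int p - 1}. B)"
    by (rule sum_norm_le) (rule bound)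
  also have "\<dots> \<le> real p * B"
    using B p0 by (simp add: mult_right_mono)
  finally show ?thesis
    using p0 unfolding B_def by (simp add: abs_mult)
qed

text \<open>A solution missed by \<open>unit_count\<close> has \<open>x j = p\<close> for all
  \<open>j\<close> in \<open>J\<close>. Even with the congruence dropped, only
  \<open>s - card J\<close> coordinates stay free.\<close>

lemma local_count_1_le_unit_count:
  assumes J: "J \<subseteq> {..<s}" and "p > 0"
  shows "local_count k s a p 1 \<le> unit_count k s a p J 1 + p ^ (s - card J)"
proof -
  let ?X = "{..<s} \<rightarrow>\<^sub>E {1..int p}"
  let ?N = "({..<s} \<rightarrow>\<^sub>E {1..int p}) \<inter> {x. \<forall>j\<in>J. int p dvd x j}"
  have fJ: "finite J" using J finite_subset by blast
  have "local_count k s a p 1 \<le> card ({x \<in> ?X. (\<exists>j\<in>J. \<not> int p dvd x j) \<and>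
      int p ^ 1 dvd (\<Sum>j<s. a j * x j ^ k)} \<union> ?N)"
    unfolding local_count_def power_one_right
    by (intro card_mono) (auto intro!: finite_PiE finite_UnI finite_Collect_conjI)
  also have "\<dots> \<le> unit_count k s a p J 1 + card ?N"
    unfolding unit_count_def power_one_right by (rule card_Un_le)
  also have "card ?N \<le> card (Pi\<^sub>E {..<s} (\<lambda>j. if j \<in> J then {int p} else {1..int p}))"
  proof (intro card_mono subsetI finite_PiE)
    fix x assume x: "x \<in> ?N"
    show "x \<in> Pi\<^sub>E {..<s} (\<lambda>j. if j \<in> J then {int p} else {1..int p})"
    proof (rule PiE_I)
      fix j assume j: "j \<in> {..<s}"
      then have 1: "1 \<le> x j" "x j \<le> int p" using x by auto
      moreover have "x j = int p" if "j \<in> J"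
      proof -
        have "int p dvd x j" using x that by auto
        then have "int p \<le> x j" using 1 by (intro zdvd_imp_le) auto
        with 1 show ?thesis by simp
      qed
      ultimately show "x j \<in> (if j \<in> J then {int p} else {1..int p})" by auto
    next
      fix j assume "j \<notin> {..<s}"
      then show "x j = undefined" using x by (blast intro: PiE_arb)
    qed
  qed auto
  also have "card (Pi\<^sub>E {..<s} (\<lambda>j. if j \<in> J then {int p} else {1..int p})) = p ^ (s - card J)"
  proof -
    have "card (Pi\<^sub>E {..<s} (\<lambda>j. if j \<in> J then {int p} else {1..int p}))
        = (\<Prod>j<s. if j \<in> J then 1 else p)"
      by (subst card_PiE) (auto intro!: prod.cong)
    also have "\<dots> = (\<Prod>j\<in>{..<s} - J. p)"
      using J by (intro prod.mono_neutral_cong_right) auto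
    finally show ?thesis using J fJ by (simp add: card_Diff_subset)
  qed
  finally show ?thesis by simp
qed

lemma unit_count_mono:
  assumes "J \<subseteq> J'"
  shows "unit_count k s a p J h \<le> unit_count k s a p J' h"
  unfolding unit_count_def using assms
  by (intro card_mono finite_Collect_conjI) (auto intro!: finite_PiE)

lemma unit_count_le_local_count: "unit_count k s a p J h \<le> local_count k s a p h"
  unfolding unit_count_def local_count_def
  by (intro card_mono finite_Collect_conjI) (auto intro!: finite_PiE)

lemma unit_density_bound:
  assumes p: "prime p" "k > 0" and s: "s \<ge> 6"
    and T: "T = {j. j < s \<and> \<not> int p dvd a j}" and cT: "card T \<ge> s - 1"
  shows "\<bar>real (unit_count k s a p T 1) / real p ^ (s - 1) - 1\<bar>
       \<le> ((2 * real k) ^ s + 1) / sqrt (real p) ^ 3"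
proof -
  define r where "r = sqrt (real p)"
  have p1: "p > 1" using p prime_gt_1_nat by auto
  then have r: "r \<ge> 1" "r > 0" and r2: "real p = r ^ 2" by (simp_all add: r_def)
  have Ts: "T \<subseteq> {..<s}" "finite T" unfolding T by auto
  have t: "card T \<le> s" using card_mono[OF _ Ts(1)] by simp
  \<comment> \<open>In terms of r = sqrt p, both error terms are at most a constant times
    \<open>p^(s - card T) * r^(t' + 2)\<close>, while the main term is
    \<open>p^(s - card T) * r^(2 * t' + 2)\<close>. The quotient is \<open>r^-t'\<close>, and five
    units give \<open>t' >= 3\<close>.\<close>
  define t' where "t' = card T - 2"
  have t': "card T = t' + 2" "t' \<ge> 3" using cT s by (auto simp: t'_def)
  have ps: "real p ^ (s - 1) = real p ^ (s - card T) * r ^ (2 * t' + 2)"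
  proof -
    have "s - 1 = (s - card T) + (t' + 1)" using t t' by auto
    then have "real p ^ (s - 1) = real p ^ (s - card T) * real p ^ (t' + 1)"
      by (simp only: power_add)
    also have "real p ^ (t' + 1) = r ^ (2 * (t' + 1))"
      by (simp only: r2 power_mult)
    finally show ?thesis by simp
  qed
  have lc: "\<bar>real (local_count k s a p 1) - real p ^ (s - 1)\<bar>
      \<le> real p ^ (s - card T) * (2 * real k * r) ^ card T"
    unfolding r_def using s by (intro local_count_1_bound p T) auto
  have "real (local_count k s a p 1) \<le> real (unit_count k s a p T 1 + p ^ (s - card T))"
    using local_count_1_le_unit_count[OF Ts(1)] p1 by (intro of_nat_mono) simp
  moreover have "real (unit_count k s a p T 1) \<le> real (local_count k s a p 1)"
    using unit_count_le_local_count by (rule of_nat_mono)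
  ultimately have "\<bar>real (unit_count k s a p T 1) - real p ^ (s - 1)\<bar>
      \<le> real p ^ (s - card T) * (2 * real k * r) ^ card T + real p ^ (s - card T)"
    using lc by simp
  also have "\<dots> = real p ^ (s - card T) * ((2 * real k) ^ card T * r ^ (t' + 2) + 1)"
    unfolding t'(1) by (simp add: power_mult_distrib ring_distribs)
  also have "\<dots> \<le> real p ^ (s - card T) * ((2 * real k) ^ s * r ^ (t' + 2) + r ^ (t' + 2))"
    using p t r by (intro mult_left_mono add_mono mult_right_mono power_increasing one_le_power) auto
  also have "\<dots> = ((2 * real k) ^ s + 1) * (real p ^ (s - card T) * r ^ (t' + 2))"
    by (simp add: algebra_simps)
  also have "\<dots> \<le> ((2 * real k) ^ s + 1) * (real p ^ (s - 1) / r ^ 3)"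
  proof (intro mult_left_mono)
    have "r ^ (t' + 2) * r ^ 3 \<le> r ^ (2 * t' + 2)"
      unfolding power_add[symmetric] using r t' by (intro power_increasing) auto
    then show "real p ^ (s - card T) * r ^ (t' + 2) \<le> real p ^ (s - 1) / r ^ 3"
      unfolding ps using r(2) by (simp add: pos_le_divide_eq mult.assoc mult_left_mono)
  qed (use p in auto)
  finally have "\<bar>real (unit_count k s a p T 1) - real p ^ (s - 1)\<bar>
      \<le> ((2 * real k) ^ s + 1) / r ^ 3 * real p ^ (s - 1)" by simp
  moreover have "real (unit_count k s a p T 1) / real p ^ (s - 1) - 1
     = (real (unit_count k s a p T 1) - real p ^ (s - 1)) / real p ^ (s - 1)"
    using p1 by (simp add: field_simps)
  ultimately show ?thesis
    using p1 unfolding r_def by (simp add: abs_divide pos_divide_le_eq)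
qed

section \<open>Lower bounds and a two-sided estimate for \<open>chi\<close>\<close>

lemma multiplicity_witness:
  assumes "prime p" "a \<noteq> 0" "k > 0"
  shows "\<exists>w. a * int k = int p ^ multiplicity (int p) (a * int k) * w \<and> \<not> int p dvd w"
proof -
  have "\<not> is_unit (int p)" using assms(1) by (auto simp: prime_nat_iff)
  with assms show ?thesis
    by (metis multiplicity_decompose' mult_eq_0_iff of_nat_0_eq_iff not_gr_zero)
qed

lemma chi_eq_multiplicity:
  assumes p: "prime p" "k > 0" and s: "k < s" and a: "\<And>j. j < s \<Longrightarrow> a j \<noteq> 0"
    and H: "\<And>j. j < s \<Longrightarrow> 2 * multiplicity (int p) (a j * int k) + 1 \<le> H"
  shows "chi k s a p = real (unit_count k s a p {..<s} H) / real p ^ (H * (s - 1)) / (1 - 1 / real p ^ (s - k))"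
proof (rule chi_eq[OF p s])
  fix j assume "j < s"
  then show "\<exists>e w. a j * int k = int p ^ e * w \<and> \<not> int p dvd w \<and> 2 * e + 1 \<le> H"
    using multiplicity_witness[OF p(1) a p(2)] H by blast
qed

lemma chi_ge_unit_density:
  assumes p: "prime p" "k > 0" and s: "k < s" and a: "\<And>j. j < s \<Longrightarrow> a j \<noteq> 0"
    and H: "\<And>j. j < s \<Longrightarrow> 2 * multiplicity (int p) (a j * int k) + 1 \<le> H"
  shows "chi k s a p \<ge> real (unit_count k s a p {..<s} H) / real p ^ (H * (s - 1))"
    and "chi k s a p = 0 \<longleftrightarrow> unit_count k s a p {..<s} H = 0"
proof -
  have p1: "real p > 1" using p prime_gt_1_nat by auto
  have d: "0 < 1 - 1 / real p ^ (s - k)" "1 - 1 / real p ^ (s - k) \<le> 1"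
    using p1 s by (auto simp: divide_simps one_less_power)
  have e: "chi k s a p = real (unit_count k s a p {..<s} H) / real p ^ (H * (s - 1)) / (1 - 1 / real p ^ (s - k))"
    by (rule chi_eq_multiplicity[OF p s a H])
  show "chi k s a p \<ge> real (unit_count k s a p {..<s} H) / real p ^ (H * (s - 1))"
    unfolding e using d mult_right_le_one_le[of "real (unit_count k s a p {..<s} H) / real p ^ (H * (s - 1))"]
    by (simp only: pos_le_divide_eq) simp
  show "chi k s a p = 0 \<longleftrightarrow> unit_count k s a p {..<s} H = 0"
    unfolding e using d p1 by simp
qed

text \<open>The density is an integer over \<open>p^(H(s-1))\<close>, so if it is not zero its
  numerator is at least 1.\<close>

lemma chi_lower_bound:
  assumes p: "prime p" "k > 0" and s: "k < s" and a: "\<And>j. j < s \<Longrightarrow> a j \<noteq> 0"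
    and H: "\<And>j. j < s \<Longrightarrow> 2 * multiplicity (int p) (a j * int k) + 1 \<le> H"
    and nz: "chi k s a p \<noteq> 0"
  shows "chi k s a p \<ge> 1 / real p ^ (H * (s - 1))"
proof -
  have "unit_count k s a p {..<s} H \<noteq> 0"
    using chi_ge_unit_density(2)[where a = a, OF p s a H] nz by simp
  then have "1 / real p ^ (H * (s - 1)) \<le> real (unit_count k s a p {..<s} H) / real p ^ (H * (s - 1))"
    by (intro divide_right_mono) auto
  also have "\<dots> \<le> chi k s a p" by (rule chi_ge_unit_density(1)[where a = a, OF p s a H])
  finally show ?thesis .
qed

text \<open>The level \<open>H\<close> required by \<open>chi\<close> may be large because of one
  coefficient that is highly divisible by p. Keeping only solutions with a unit coordinate in
  \<open>T\<close> loses little, and for these the density is already the one at level 1, where the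
  character sum estimate applies.\<close>

lemma chi_ge_of_few_bad_coefficients:
  assumes p: "prime p" "k > 0" "\<not> p dvd k" and s: "k < s" "s \<ge> 6"
    and a: "\<And>j. j < s \<Longrightarrow> a j \<noteq> 0"
    and T: "T = {j. j < s \<and> \<not> int p dvd a j}" and cT: "card T \<ge> s - 1"
  shows "chi k s a p \<ge> 1 - ((2 * real k) ^ s + 1) / sqrt (real p) ^ 3"
proof -
  have p1: "p > 1" using p prime_gt_1_nat by auto
  \<comment> \<open>A sum in place of a maximum: any common upper bound for the required levels will
    do.\<close>
  define H where "H = (\<Sum>j<s. 2 * multiplicity (int p) (a j * int k) + 1)"
  have H: "2 * multiplicity (int p) (a j * int k) + 1 \<le> H" if "j < s" for j
    unfolding H_def using that by (intro member_le_sum[where f = "\<lambda>j. 2 * multiplicity (int p) (a j * int k) + 1"]) auto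
  have "H \<ge> 1" using H[of 0] s by simp
  have "unit_count k s a p T H = (p ^ (H - 1)) ^ (s - 1) * unit_count k s a p T 1"
  proof (rule unit_count_stable[OF _ p(1) _ \<open>H \<ge> 1\<close>])
    fix j assume "j \<in> T"
    then have "\<not> int p dvd a j * int k"
      using p T by (simp add: prime_dvd_mult_iff)
    then show "\<exists>e w. a j * int k = int p ^ e * w \<and> \<not> int p dvd w \<and> 2 * e + 1 \<le> 1"
      by (intro exI[of _ 0] exI[of _ "a j * int k"]) simp
  qed (auto simp: T)
  moreover have "real p ^ (H * (s - 1)) = (real p ^ (H - 1)) ^ (s - 1) * real p ^ (s - 1)"
    using \<open>H \<ge> 1\<close> by (cases H) (auto simp: power_add power_mult[symmetric])
  ultimately have "real (unit_count k s a p T 1) / real p ^ (s - 1)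
      = real (unit_count k s a p T H) / real p ^ (H * (s - 1))"
    using p1 by simp
  also have "\<dots> \<le> real (unit_count k s a p {..<s} H) / real p ^ (H * (s - 1))"
    by (intro divide_right_mono of_nat_mono unit_count_mono) (auto simp: T)
  also have "\<dots> \<le> chi k s a p"
    by (rule chi_ge_unit_density(1)[where a = a, OF p(1,2) s(1) a H])
  finally show ?thesis
    using unit_density_bound[OF p(1,2) s(2) T cT] by linarith
qed

text \<open>A two-sided estimate is needed for the convergence of the product, where all but
  finitely many primes divide neither \<open>k\<close> nor any coefficient. The factor 2 bounds 1/(1
  - \<open>\<rho>\<close>), and \<open>\<rho>\<close> itself is at most p^(-3), which is absorbed by
  p^(-3/2).\<close>

lemma abs_chi_minus_1_le:
  assumes p: "prime p" "k > 0" "\<not> p dvd k" and s: "k + 3 \<le> s" "s \<ge> 6"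
    and a: "\<And>j. j < s \<Longrightarrow> \<not> int p dvd a j"
  shows "\<bar>chi k s a p - 1\<bar> \<le> 2 * ((2 * real k) ^ s + 2) / sqrt (real p) ^ 3"
proof -
  define u where "u = real (unit_count k s a p {..<s} 1) / real p ^ (s - 1)"
  define \<rho> where "\<rho> = 1 / real p ^ (s - k)"
  have p2: "real p \<ge> 2" using p prime_ge_2_nat by auto
  have T: "{..<s} = {j. j < s \<and> \<not> int p dvd a j}" using a by auto
  have mult: "2 * multiplicity (int p) (a j * int k) + 1 \<le> 1" if "j < s" for j
  proof -
    have "\<not> int p dvd a j * int k"
      using p a[OF that] by (simp add: prime_dvd_mult_iff)
    then show ?thesis by (simp add: not_dvd_imp_multiplicity_0)
  qed
  have chi: "chi k s a p = u / (1 - \<rho>)"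
    using chi_eq_multiplicity[where a = a and H = 1 and s = s, OF p(1,2) _ _ mult] a s
    unfolding u_def \<rho>_def by force
  have u: "\<bar>u - 1\<bar> \<le> ((2 * real k) ^ s + 1) / sqrt (real p) ^ 3"
    unfolding u_def using s by (intro unit_density_bound p(1,2) T) auto
  have \<rho>: "0 \<le> \<rho>" "\<rho> \<le> 1 / 2" "\<rho> \<le> 1 / sqrt (real p) ^ 3"
  proof -
    have "sqrt (real p) \<le> real p" using p2 by (intro real_le_lsqrt) (auto simp: power2_eq_square)
    then have "sqrt (real p) ^ 3 \<le> real p ^ 3" by (intro power_mono) auto
    also have "\<dots> \<le> real p ^ (s - k)" using p2 s by (intro power_increasing) auto
    finally show "\<rho> \<le> 1 / sqrt (real p) ^ 3"
      unfolding \<rho>_def using p2 by (intro divide_left_mono) auto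
    have "2 \<le> real p ^ 1" using p2 by simp
    also have "\<dots> \<le> real p ^ (s - k)" using p2 s by (intro power_increasing) auto
    finally show "\<rho> \<le> 1 / 2"
      unfolding \<rho>_def using p2 by (intro divide_left_mono) auto
  qed (simp add: \<rho>_def)
  have "\<bar>chi k s a p - 1\<bar> = \<bar>u - 1 + \<rho>\<bar> / (1 - \<rho>)"
  proof -
    have "u / (1 - \<rho>) - 1 = (u - 1 + \<rho>) / (1 - \<rho>)" using \<rho> by (simp add: field_simps)
    then show ?thesis using \<rho> by (simp add: chi abs_divide)
  qed
  also have "\<dots> \<le> (\<bar>u - 1\<bar> + \<rho>) / (1 / 2)"
    using \<rho> by (intro frac_le) auto
  also have "\<dots> \<le> 2 * (((2 * real k) ^ s + 1) / sqrt (real p) ^ 3 + 1 / sqrt (real p) ^ 3)"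
  proof -
    have "(\<bar>u - 1\<bar> + \<rho>) / (1 / 2) = 2 * (\<bar>u - 1\<bar> + \<rho>)" by simp
    also have "\<dots> \<le> 2 * (((2 * real k) ^ s + 1) / sqrt (real p) ^ 3 + 1 / sqrt (real p) ^ 3)"
      by (intro mult_left_mono add_mono u \<rho>) auto
    finally show ?thesis .
  qed
  also have "\<dots> = 2 * ((2 * real k) ^ s + 2) / sqrt (real p) ^ 3"
    by (simp add: add_divide_distrib[symmetric])
  finally show ?thesis .
qed

section \<open>The singular series\<close>

lemma summable_inverse_sqrt_cube: "summable (\<lambda>n. c / sqrt (real n) ^ 3)"
proof -
  have "c / sqrt (real n) ^ 3 = c * real n powr (- 3 / 2)" for n
  proof (cases "n = 0")
    case False
    have "sqrt (real n) = real n powr (1 / 2)" by (simp add: powr_half_sqrt)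
    then have "sqrt (real n) ^ 3 = (real n powr (1 / 2)) ^ 3" by (rule arg_cong)
    also have "\<dots> = real n powr (3 / 2)" using False by (subst powr_power) simp_all
    finally have "sqrt (real n) ^ 3 = real n powr (3 / 2)" .
    moreover have "real n powr (- 3 / 2) = inverse (real n powr (3 / 2))"
      using powr_minus[of "real n" "3 / 2"] by simp
    ultimately show ?thesis by (simp only: divide_inverse)
  qed simp
  moreover have "summable (\<lambda>n. c * real n powr (- 3 / 2))"
    by (intro summable_mult) (simp add: summable_real_powr_iff)
  ultimately show ?thesis by simp
qed

lemma summable_finite_tail_sums_le:
  fixes g :: "nat \<Rightarrow> real"
  assumes "summable g" "\<And>n. g n \<ge> 0" "e > 0"
  shows "\<exists>N. \<forall>B. finite B \<and> B \<subseteq> {N..} \<longrightarrow> sum g B \<le> e"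
proof -
  obtain N where N: "\<And>m n. m \<ge> N \<Longrightarrow> norm (sum g {m..<n}) < e"
    using assms(1,3) unfolding summable_Cauchy by blast
  have "sum g B \<le> e" if B: "finite B" "B \<subseteq> {N..}" for B
  proof -
    have "B \<subseteq> {N..<Suc (Max B)}" using B by (auto simp: less_Suc_eq_le)
    then have "sum g B \<le> sum g {N..<Suc (Max B)}"
      using assms(2) by (intro sum_mono2) auto
    then show ?thesis using N[of N "Suc (Max B)"] by simp
  qed
  then show ?thesis by blast
qed

text \<open>\<open>sing_series\<close> is a \<open>lim\<close>, which carries information only once
  the partial products are known to converge. Absolute convergence follows from the two-sided
  estimate at primes beyond \<open>M\<close>.\<close>

lemma sing_series_LIMSEQ:
  assumes k: "k > 0" and s: "k + 3 \<le> s" "s \<ge> 6" and a: "\<And>j. j < s \<Longrightarrow> a j \<noteq> 0"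
  shows "(\<lambda>N. \<Prod>p\<in>{p. prime p \<and> p \<le> N}. chi k s a p) \<longlonglongrightarrow> sing_series k s a"
proof -
  define f where "f n = (if prime n then chi k s a n else 1)" for n
  have prod: "(\<Prod>p\<in>{p. prime p \<and> p \<le> N}. chi k s a p) = (\<Prod>n\<le>N. f n)" for N
  proof -
    have "{p. prime p \<and> p \<le> N} = {p \<in> {..N}. prime p}" by auto
    then show ?thesis unfolding f_def by (simp only: prod.inter_filter finite_atMost)
  qed
  define C where "C = 2 * ((2 * real k) ^ s + 2)"
  \<comment> \<open>A prime beyond \<open>M\<close> exceeds \<open>k\<close> and every
    \<open>\<bar>a j\<bar>\<close>, hence divides none of them.\<close>
  define M where "M = k + (\<Sum>j<s. nat \<bar>a j\<bar>)"
  have "norm (norm (f n - 1)) \<le> C / sqrt (real n) ^ 3" if n: "n > M" for n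
  proof (cases "prime n")
    case True
    have "\<not> n dvd k" using n k unfolding M_def by (auto dest: dvd_imp_le)
    moreover have "\<not> int n dvd a j" if j: "j < s" for j
    proof
      assume "int n dvd a j"
      then have "int n \<le> \<bar>a j\<bar>" using a[OF j] dvd_imp_le_int[of "a j" "int n"] by simp
      moreover have "nat \<bar>a j\<bar> \<le> (\<Sum>j<s. nat \<bar>a j\<bar>)"
        using j by (intro member_le_sum[where f = "\<lambda>j. nat \<bar>a j\<bar>"]) auto
      ultimately show False using n unfolding M_def by linarith
    qed
    ultimately show ?thesis
      using abs_chi_minus_1_le[of n k s a] True k s unfolding f_def C_def by simp
  qed (simp add: f_def C_def)
  then have "summable (\<lambda>n. norm (f n - 1))"
    by (intro summable_comparison_test'[OF summable_inverse_sqrt_cube, of "Suc M" _ C]) simp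
  then have "convergent_prod f"
    by (intro abs_convergent_prod_imp_convergent_prod summable_imp_abs_convergent_prod)
  then have "(\<lambda>N. \<Prod>p\<in>{p. prime p \<and> p \<le> N}. chi k s a p) \<longlonglongrightarrow> prodinf f"
    unfolding prod by (rule convergent_prod_LIMSEQ)
  then show ?thesis unfolding sing_series_def by (simp add: limI)
qed

lemma chi_nonzero_of_sing_series_nonzero:
  assumes "k > 0" "k + 3 \<le> s" "s \<ge> 6" "\<And>j. j < s \<Longrightarrow> a j \<noteq> 0"
    and nz: "sing_series k s a \<noteq> 0" and p: "prime p"
  shows "chi k s a p \<noteq> 0"
proof
  assume 0: "chi k s a p = 0"
  have "eventually (\<lambda>N. (\<Prod>p\<in>{p. prime p \<and> p \<le> N}. chi k s a p) = 0) sequentially"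
    using eventually_ge_at_top[of p]
  proof eventually_elim
    case (elim N)
    have "finite {p. prime p \<and> p \<le> N}" by simp
    then show ?case using p 0 elim by (intro prod_zero) auto
  qed
  then have "(\<lambda>N. \<Prod>p\<in>{p. prime p \<and> p \<le> N}. chi k s a p) \<longlonglongrightarrow> 0"
    by (rule tendsto_eventually)
  then show False
    using LIMSEQ_unique[OF sing_series_LIMSEQ[where a = a, OF assms(1-4)]] nz by blast
qed

section \<open>Products over the bad primes and the uniform lower bound\<close>

lemma prod_prime_multiplicity_le:
  fixes n :: int
  assumes "finite B" "\<And>p. p \<in> B \<Longrightarrow> prime p" "n \<noteq> 0"
  shows "(\<Prod>p\<in>B. int p ^ multiplicity (int p) n) \<le> \<bar>n\<bar>"
proof -
  let ?B = "int ` B \<inter> prime_factors n"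
  have "(\<Prod>p\<in>B. int p ^ multiplicity (int p) n) = (\<Prod>q\<in>int ` B. q ^ multiplicity q n)"
    by (simp add: prod.reindex)
  also have "\<dots> = (\<Prod>q\<in>?B. q ^ multiplicity q n)"
  proof (rule prod.mono_neutral_right)
    show "\<forall>q\<in>int ` B - ?B. q ^ multiplicity q n = 1"
      using assms by (auto simp: prime_factors_multiplicity)
  qed (use assms in auto)
  also have "\<dots> \<le> (\<Prod>q\<in>prime_factors n. q ^ multiplicity q n)"
  proof (rule prod_mono2)
    fix q assume "q \<in> prime_factors n - ?B"
    then have "q > 0" using in_prime_factors_imp_prime prime_gt_0_int by blast
    then show "1 \<le> q ^ multiplicity q n" by simp
  next
    fix q assume "q \<in> ?B"
    then show "0 \<le> q ^ multiplicity q n" by auto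
  qed auto
  also have "\<dots> = \<bar>n\<bar>"
    using prod_prime_factors[OF assms(3)] by simp
  finally show ?thesis .
qed

lemma prod_prime_divisors_le:
  fixes n :: int
  assumes "finite B" "\<And>p. p \<in> B \<Longrightarrow> prime p" "\<And>p. p \<in> B \<Longrightarrow> int p dvd n" "n \<noteq> 0"
  shows "(\<Prod>p\<in>B. int p) \<le> \<bar>n\<bar>"
proof -
  have "(\<Prod>p\<in>B. int p) \<le> (\<Prod>p\<in>B. int p ^ multiplicity (int p) n)"
  proof (rule prod_mono)
    fix p assume p: "p \<in> B"
    have "prime (int p)" using assms(2)[OF p] by simp
    then have "multiplicity (int p) n > 0"
      using assms(3)[OF p] assms(4) by (simp add: prime_multiplicity_gt_zero_iff)
    then have "int p ^ 1 \<le> int p ^ multiplicity (int p) n"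
      using assms(2)[OF p] by (intro power_increasing) (auto simp: prime_ge_Suc_0_nat)
    then show "0 \<le> int p \<and> int p \<le> int p ^ multiplicity (int p) n" by simp
  qed
  also have "\<dots> \<le> \<bar>n\<bar>" by (rule prod_prime_multiplicity_le) (use assms in auto)
  finally show ?thesis .
qed

text \<open>The constants are chosen before \<open>a\<close> and \<open>G\<close>, which is what
  makes the final estimate uniform. Bad primes get the trivial bound, whose total cost is a power of
  \<open>G\<close>; the good ones together cost at most a factor 2.\<close>

lemma sing_series_lower_bound:
  fixes k s :: nat
  assumes k: "k > 0" and s: "k + 3 \<le> s" "s \<ge> 6"
  shows "\<exists>c>0. \<exists>K>0. \<forall>a G. (\<forall>j<s. a j \<noteq> 0) \<longrightarrow> sing_series k s a \<noteq> 0
     \<longrightarrow> (\<forall>i<s. \<forall>j<s. i \<noteq> j \<longrightarrow> real_of_int (gcd (a i) (a j)) \<le> G)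
     \<longrightarrow> (\<forall>j<s. real_of_int (square_part (a j)) \<le> G)
     \<longrightarrow> 1 / (c * G ^ K) \<le> sing_series k s a"
proof -
  define g where "g n = ((2 * real k) ^ s + 1) / sqrt (real n) ^ 3" for n
  have g0: "g n \<ge> 0" for n by (simp add: g_def)
  have "\<exists>N. \<forall>B. finite B \<and> B \<subseteq> {N..} \<longrightarrow> sum g B \<le> 1 / 2"
    using g0 unfolding g_def by (intro summable_finite_tail_sums_le summable_inverse_sqrt_cube) auto
  then obtain P1 where P1: "\<And>B. finite B \<Longrightarrow> B \<subseteq> {P1..} \<Longrightarrow> sum g B \<le> 1 / 2" by blast
  define P0 where "P0 = max P1 k"
  \<comment> \<open>\<open>E\<close> and \<open>c0\<close> are the exponent and the constant in
    \<open>D^3 * Q^4 <= c0 * G^E\<close>, where \<open>D <= P0! * G^(s*s)\<close> and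
    \<open>Q <= k * G^s\<close>.\<close>
  define E where "E = 3 * (s * s) + 4 * s"
  define c0 where "c0 = (fact P0) ^ 3 * real k ^ 4"
  have c0: "c0 > 0" using k by (simp add: c0_def)
  have main: "1 / (2 * c0 ^ (s - 1) * G ^ (E * (s - 1))) \<le> sing_series k s a"
    if a: "\<forall>j<s. a j \<noteq> 0" and nz: "sing_series k s a \<noteq> 0"
      and G1: "\<forall>i<s. \<forall>j<s. i \<noteq> j \<longrightarrow> real_of_int (gcd (a i) (a j)) \<le> G"
      and G2: "\<forall>j<s. real_of_int (square_part (a j)) \<le> G" for a G
  proof -
    have a': "\<And>j. j < s \<Longrightarrow> a j \<noteq> 0" using a by blast
    have chi_nz: "chi k s a p \<noteq> 0" if "prime p" for p
      by (rule chi_nonzero_of_sing_series_nonzero[OF k s a' nz that])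
    \<comment> \<open>The diagonal is set to 1, since the gcd of \<open>a i\<close> with itself
      would bring in the full size of the coefficient.\<close>
    define gg where "gg i j = (if i = j then 1 else gcd (a i) (a j))" for i j
    \<comment> \<open>The factorial makes every prime up to \<open>P0\<close> a divisor of
      \<open>D\<close>, so the bad primes are precisely the prime divisors of
      \<open>D\<close>.\<close>
    define D where "D = fact P0 * (\<Prod>i<s. \<Prod>j<s. gg i j)"
    define Q where "Q = int k * (\<Prod>j<s. square_part (a j))"
    have sq: "square_part (a j) \<ge> 1" if "j < s" for j
    proof -
      have "square_part (a j) \<noteq> 0" using a that by simp
      moreover have "square_part (a j) = \<bar>square_part (a j)\<bar>"
        using normalize_square_part[of "a j"] by simp
      ultimately show ?thesis by linarith
    qed
    have "G \<ge> 1" using G2 sq[of 0] s by (metis less_le_trans of_int_1_le_iff order_trans zero_less_numeral)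
    have gg: "1 \<le> gg i j" "real_of_int (gg i j) \<le> G" if "i < s" "j < s" for i j
    proof -
      have "gcd (a i) (a j) \<noteq> 0" using a that by simp
      moreover have "gcd (a i) (a j) \<ge> 0" by simp
      ultimately have "gcd (a i) (a j) \<ge> 1" by linarith
      then show "1 \<le> gg i j" by (simp add: gg_def)
      show "real_of_int (gg i j) \<le> G" using G1 that \<open>G \<ge> 1\<close> by (simp add: gg_def)
    qed
    have D0: "D \<noteq> 0" "D \<ge> 0"
    proof -
      have "(\<Prod>i<s. \<Prod>j<s. gg i j) > 0"
        by (intro prod_pos ballI) (use gg in \<open>force\<close>)
      then have "D > 0" unfolding D_def by (intro mult_pos_pos) simp_all
      then show "D \<noteq> 0" "D \<ge> 0" by simp_all
    qed
    have Q0: "Q \<noteq> 0" "Q \<ge> 0"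
    proof -
      have "(\<Prod>j<s. square_part (a j)) > 0"
        by (intro prod_pos ballI) (use sq in \<open>force\<close>)
      then have "Q > 0" unfolding Q_def using k by (intro mult_pos_pos) simp_all
      then show "Q \<noteq> 0" "Q \<ge> 0" by simp_all
    qed
    have Dle: "real_of_int D \<le> fact P0 * G ^ (s * s)"
    proof -
      have "(\<Prod>i<s. \<Prod>j<s. real_of_int (gg i j)) \<le> (\<Prod>i<s. \<Prod>j<s. G)"
      proof (intro prod_mono conjI prod_nonneg ballI)
        fix i j assume "i \<in> {..<s}" "j \<in> {..<s}"
        then show "0 \<le> real_of_int (gg i j)" "real_of_int (gg i j) \<le> G"
          using gg[of i j] by auto
        then show "0 \<le> real_of_int (gg i j)" by simp
      qed
      then show ?thesis unfolding D_def by (simp add: power_mult mult_left_mono)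
    qed
    have Qle: "real_of_int Q \<le> real k * G ^ s"
    proof -
      have "(\<Prod>j<s. real_of_int (square_part (a j))) \<le> (\<Prod>j<s. G)"
      proof (intro prod_mono conjI)
        fix j assume "j \<in> {..<s}"
        then show "0 \<le> real_of_int (square_part (a j))" "real_of_int (square_part (a j)) \<le> G"
          using sq[of j] G2 by auto
      qed
      then show ?thesis unfolding Q_def by (simp add: mult_left_mono)
    qed
    \<comment> \<open>An exponent of p in \<open>a j\<close> is at most 1 more than twice its
      exponent in \<open>square_part (a j)\<close>. Together with the factor \<open>k\<close> this
      gives at most 1 + 2m for \<open>a j * int k\<close>, where m is the exponent in
      \<open>Q\<close>; Hensel lifting needs 2(1 + 2m) + 1.\<close>
    define H where "H p = 3 + 4 * multiplicity (int p) Q" for p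
    have bad: "chi k s a p \<ge> 1 / real p ^ (H p * (s - 1))" if p: "prime p" for p
    proof (rule chi_lower_bound[OF p k _ a' _ chi_nz[OF p]])
      fix j assume j: "j < s"
      have pp: "prime_elem (int p)" and pi: "prime (int p)" using p by auto
      have "multiplicity (int p) (a j * int k) = multiplicity (int p) (a j) + multiplicity (int p) (int k)"
        using a j k by (intro prime_elem_multiplicity_mult_distrib pp) auto
      also have "multiplicity (int p) (a j) \<le> 1 + 2 * multiplicity (int p) (square_part (a j))"
        using prime_multiplicity_square_part[OF pi, of "a j"] by simp
      also have "1 + 2 * multiplicity (int p) (square_part (a j)) + multiplicity (int p) (int k)
          \<le> 1 + 2 * multiplicity (int p) (int k * square_part (a j))"
      proof -
        have "multiplicity (int p) (int k * square_part (a j))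
            = multiplicity (int p) (int k) + multiplicity (int p) (square_part (a j))"
          using a j k by (intro prime_elem_multiplicity_mult_distrib pp) auto
        then show ?thesis by simp
      qed
      also have "multiplicity (int p) (int k * square_part (a j)) \<le> multiplicity (int p) Q"
        unfolding Q_def using Q0(1) j unfolding Q_def
        by (intro dvd_imp_multiplicity_le mult_dvd_mono dvd_refl dvd_prodI) auto
      finally show "2 * multiplicity (int p) (a j * int k) + 1 \<le> H p"
        unfolding H_def by simp
    qed (use s in auto)
    have good: "chi k s a p \<ge> 1 - g p" if p: "prime p" "p > P0" "\<not> int p dvd D" for p
    proof -
      define T where "T = {j. j < s \<and> \<not> int p dvd a j}"
      have "\<not> p dvd k" using p(2) k unfolding P0_def by (auto dest: dvd_imp_le)
      moreover have "card T \<ge> s - 1"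
      proof -
        let ?B = "{j. j < s \<and> int p dvd a j}"
        have "\<forall>i\<in>?B. \<forall>j\<in>?B. i = j"
        proof (intro ballI, rule ccontr)
          fix i j assume ij: "i \<in> ?B" "j \<in> ?B" "i \<noteq> j"
          then have "int p dvd gg i j" by (simp add: gg_def)
          moreover have "gg i j dvd (\<Prod>j<s. gg i j)" using ij by (intro dvd_prodI) auto
          moreover have "(\<Prod>j<s. gg i j) dvd (\<Prod>i<s. \<Prod>j<s. gg i j)"
            using ij by (intro dvd_prodI[of _ _ "\<lambda>i. \<Prod>j<s. gg i j"]) auto
          ultimately have "int p dvd D" unfolding D_def by (meson dvd_mult dvd_trans)
          with p(3) show False by simp
        qed
        then have "card ?B \<le> 1" by (simp add: card_le_Suc0_iff_eq)
        moreover have "card T + card ?B = card {..<s}"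
        proof -
          have "T \<union> ?B = {..<s}" unfolding T_def by auto
          then show ?thesis unfolding T_def by (subst card_Un_disjoint[symmetric]) auto
        qed
        ultimately show ?thesis by simp
      qed
      ultimately show ?thesis
        unfolding g_def using s by (intro chi_ge_of_few_bad_coefficients[OF p(1) k _ _ _ a' T_def]) auto
    qed
    \<comment> \<open>The bound does not depend on \<open>N\<close>, so it passes to the
      limit.\<close>
    have partial: "1 / (2 * c0 ^ (s - 1) * G ^ (E * (s - 1))) \<le> (\<Prod>p\<in>{p. prime p \<and> p \<le> N}. chi k s a p)" for N
    proof -
      define B where "B = {p. prime p \<and> p \<le> N \<and> (p \<le> P0 \<or> int p dvd D)}"
      define R where "R = {p. prime p \<and> p \<le> N \<and> p > P0 \<and> \<not> int p dvd D}"
      have BR: "{p. prime p \<and> p \<le> N} = B \<union> R" "B \<inter> R = {}" "finite B" "finite R"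
        unfolding B_def R_def by auto
      have Bp: "prime p" if "p \<in> B" for p using that by (simp add: B_def)
      have BD: "int p dvd D" if "p \<in> B" for p
      proof -
        have "int p dvd D" if "p \<le> P0"
        proof -
          have "p dvd fact P0" using that \<open>p \<in> B\<close> unfolding B_def by (simp add: prime_dvd_fact_iff)
          then have "int p dvd int (fact P0)" by (simp only: int_dvd_int_iff)
          then show ?thesis unfolding D_def by (simp add: of_nat_fact)
        qed
        then show ?thesis using that unfolding B_def by auto
      qed
      \<comment> \<open>The constant part 3 of the exponent is paid for by \<open>D^3\<close>, as
        each bad prime divides \<open>D\<close>; the variable part is paid for by
        \<open>Q^4\<close>.\<close>
      have "(\<Prod>p\<in>B. int p ^ H p) = (\<Prod>p\<in>B. int p) ^ 3 * (\<Prod>p\<in>B. int p ^ multiplicity (int p) Q) ^ 4"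
        unfolding H_def power_add power_mult prod.distrib
        by (simp add: prod_power_distrib power_mult[symmetric] mult.commute)
      also have "\<dots> \<le> D ^ 3 * Q ^ 4"
      proof (intro mult_mono power_mono)
        show "(\<Prod>p\<in>B. int p) \<le> D"
          using prod_prime_divisors_le[where n = D, OF BR(3) Bp BD D0(1)] D0(2) by simp
        show "(\<Prod>p\<in>B. int p ^ multiplicity (int p) Q) \<le> Q"
          using prod_prime_multiplicity_le[where n = Q, OF BR(3) Bp Q0(1)] Q0(2) by simp
      qed (use D0 in \<open>auto intro!: prod_nonneg\<close>)
      finally have "real_of_int (\<Prod>p\<in>B. int p ^ H p) \<le> real_of_int (D ^ 3 * Q ^ 4)"
        by (simp only: of_int_le_iff)
      also have "\<dots> = real_of_int D ^ 3 * real_of_int Q ^ 4" by simp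
      also have "\<dots> \<le> (fact P0 * G ^ (s * s)) ^ 3 * (real k * G ^ s) ^ 4"
        using Dle Qle D0 Q0 \<open>G \<ge> 1\<close> by (intro mult_mono power_mono) auto
      also have "\<dots> = c0 * G ^ E"
        unfolding c0_def E_def by (simp add: power_mult_distrib power_add power_mult[symmetric] mult_ac)
      finally have Hle: "(\<Prod>p\<in>B. real p ^ H p) \<le> c0 * G ^ E" by simp
      have Hpos: "(\<Prod>p\<in>B. real p ^ H p) > 0"
        unfolding B_def by (intro prod_pos) (auto simp: prime_gt_0_nat)
      have "1 / (c0 * G ^ E) ^ (s - 1) \<le> 1 / (\<Prod>p\<in>B. real p ^ H p) ^ (s - 1)"
        using Hle Hpos c0 \<open>G \<ge> 1\<close> by (intro divide_left_mono power_mono mult_pos_pos zero_less_power) auto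
      also have "\<dots> = (\<Prod>p\<in>B. 1 / real p ^ (H p * (s - 1)))"
        by (simp add: prod_dividef power_mult prod_power_distrib)
      also have "\<dots> \<le> (\<Prod>p\<in>B. chi k s a p)"
        unfolding B_def by (intro prod_mono conjI bad) auto
      finally have prodB: "1 / (c0 * G ^ E) ^ (s - 1) \<le> (\<Prod>p\<in>B. chi k s a p)" .
      have RP: "R \<subseteq> {P1..}" unfolding R_def P0_def by auto
      have g01: "g p \<in> {0..1}" if "p \<in> R" for p
        using P1[of "{p}"] RP that g0[of p] by auto
      have "1 / 2 \<le> 1 - sum g R" using P1[OF BR(4) RP] by simp
      \<comment> \<open>A product of terms 1 - g is at least 1 minus the sum of the g, and
        \<open>P1\<close> was chosen to keep that sum below 1/2.\<close>
      also have "\<dots> \<le> (\<Prod>p\<in>R. 1 - g p)" by (rule Weierstrass_prod_ineq) (rule g01)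
      also have "\<dots> \<le> (\<Prod>p\<in>R. chi k s a p)"
      proof (intro prod_mono conjI)
        fix p assume "p \<in> R"
        then show "0 \<le> 1 - g p" "1 - g p \<le> chi k s a p"
          using g01[of p] good[of p] unfolding R_def by auto
      qed
      finally have prodR: "1 / 2 \<le> (\<Prod>p\<in>R. chi k s a p)" .
      have "1 / (2 * c0 ^ (s - 1) * G ^ (E * (s - 1))) = 1 / (c0 * G ^ E) ^ (s - 1) * (1 / 2)"
        by (simp add: power_mult_distrib power_mult)
      also have "\<dots> \<le> (\<Prod>p\<in>B. chi k s a p) * (\<Prod>p\<in>R. chi k s a p)"
        using c0 \<open>G \<ge> 1\<close> by (intro mult_mono prodB prodR order_trans[OF _ prodB]) auto
      also have "\<dots> = (\<Prod>p\<in>{p. prime p \<and> p \<le> N}. chi k s a p)"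
        unfolding BR(1) using BR by (intro prod.union_disjoint[symmetric]) auto
      finally show ?thesis .
    qed
    show ?thesis
      by (rule LIMSEQ_le_const[OF sing_series_LIMSEQ[OF k s a']]) (use partial in auto)
  qed
  show ?thesis
  proof (intro exI conjI allI impI)
    show "(0::real) < 2 * c0 ^ (s - 1)" using c0 by simp
    show "0 < E * (s - 1)" using s unfolding E_def by simp
  qed (rule main; blast)
qed

section \<open>Exceptional coefficient vectors\<close>

text \<open>Leaving out 0 removes the additive 1 from the count of multiples, so the bound stays
  valid for d > A, where the set is empty.\<close>

lemma card_bounded_multiples_le:
  fixes A :: real and d :: nat
  assumes "A \<ge> 0" "d > 0"
  shows "finite {x::int. x \<noteq> 0 \<and> real_of_int \<bar>x\<bar> \<le> A \<and> int d dvd x}" (is "finite ?X")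
    and "real (card {x::int. x \<noteq> 0 \<and> real_of_int \<bar>x\<bar> \<le> A \<and> int d dvd x}) \<le> 2 * A / real d"
proof -
  define m where "m = \<lfloor>A / real d\<rfloor>"
  have m: "m \<ge> 0" using assms by (simp add: m_def)
  have sub: "?X \<subseteq> (\<lambda>t. int d * t) ` ({-m..m} - {0})"
  proof
    fix x assume x: "x \<in> ?X"
    then obtain t where t: "x = int d * t" by (auto elim: dvdE)
    have "real d * real_of_int \<bar>t\<bar> \<le> A" using x t by (simp add: abs_mult)
    then have "real_of_int \<bar>t\<bar> \<le> A / real d" using assms by (simp add: field_simps)
    then have "\<bar>t\<bar> \<le> m" by (simp add: m_def le_floor_iff)
    moreover have "t \<noteq> 0" using x t by auto
    ultimately show "x \<in> (\<lambda>t. int d * t) ` ({-m..m} - {0})"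
      unfolding t by (intro imageI) auto
  qed
  then show "finite ?X" by (rule finite_subset) simp
  have "card ?X \<le> card ((\<lambda>t. int d * t) ` ({-m..m} - {0}))"
    by (rule card_mono[OF _ sub]) simp
  also have "\<dots> \<le> card ({-m..m} - {0})" by (rule card_image_le) simp
  also have "\<dots> = nat (2 * m)" using m by (simp add: card_Diff_singleton nat_diff_distrib)
  finally have "real (card ?X) \<le> 2 * real_of_int m" using m by linarith
  also have "\<dots> \<le> 2 * (A / real d)"
    unfolding m_def by (intro mult_left_mono of_int_floor_le) auto
  finally show "real (card ?X) \<le> 2 * A / real d" by simp
qed

lemma sum_inverse_squares_tail_le:
  fixes G :: real
  assumes "G > 0"
  shows "(\<Sum>d\<in>{d::nat. G < real d \<and> d \<le> M}. 1 / real d ^ 2) \<le> 2 / G"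
proof -
  define n where "n = nat \<lfloor>G\<rfloor> + 1"
  have n: "real n \<ge> G" "n \<ge> 1" unfolding n_def using assms by linarith+
  have "(\<Sum>d\<in>{d::nat. G < real d \<and> d \<le> M}. 1 / real d ^ 2) \<le> (\<Sum>d\<in>{n..<Suc M}. 1 / real d ^ 2)"
  proof (intro sum_mono2 subsetI)
    fix d assume "d \<in> {d::nat. G < real d \<and> d \<le> M}"
    then have "G < real d" "d \<le> M" by auto
    then have "\<lfloor>G\<rfloor> < int d" by linarith
    then show "d \<in> {n..<Suc M}" using \<open>d \<le> M\<close> assms unfolding n_def by auto linarith
  qed auto
  \<comment> \<open>For d >= 1, 1/d^2 is at most 2/(d(d+1)), which telescopes.\<close>
  also have "\<dots> \<le> (\<Sum>d\<in>{n..<Suc M}. 2 / real d - 2 / real (Suc d))"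
  proof (rule sum_mono)
    fix d assume "d \<in> {n..<Suc M}"
    then have d: "real d \<ge> 1" using n by simp
    have "2 / real d - 2 / real (Suc d) = 2 / (real d * (real d + 1))"
      using d by (simp add: field_simps)
    moreover have "1 / real d ^ 2 \<le> 2 / (real d * (real d + 1))"
      using d by (simp add: divide_simps power2_eq_square)
    ultimately show "1 / real d ^ 2 \<le> 2 / real d - 2 / real (Suc d)" by simp
  qed
  also have "\<dots> \<le> 2 / real n"
  proof (cases "n \<le> Suc M")
    case True
    have "(\<Sum>d\<in>{n..<Suc M}. 2 / real d - 2 / real (Suc d)) = 2 / real n - 2 / real (Suc M)"
      using sum_Suc_diff'[OF True, of "\<lambda>d. - (2 / real d)"] by simp
    then show ?thesis by simp
  qed simp
  also have "\<dots> \<le> 2 / G" using n assms by (intro divide_left_mono) auto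
  finally show ?thesis .
qed

lemma card_box_multiples_le:
  fixes A :: real and m :: "nat \<Rightarrow> nat"
  assumes A: "A \<ge> 0" and m: "\<And>j. j < s \<Longrightarrow> m j > 0"
  defines "X \<equiv> \<lambda>d. {x::int. x \<noteq> 0 \<and> real_of_int \<bar>x\<bar> \<le> A \<and> int d dvd x}"
  shows "finite (Pi\<^sub>E {..<s} (\<lambda>j. X (m j)))"
    and "real (card (Pi\<^sub>E {..<s} (\<lambda>j. X (m j)))) \<le> (2 * A) ^ s / (\<Prod>j<s. real (m j))"
proof -
  show "finite (Pi\<^sub>E {..<s} (\<lambda>j. X (m j)))"
    unfolding X_def using A m by (intro finite_PiE card_bounded_multiples_le(1)) auto
  have "real (card (Pi\<^sub>E {..<s} (\<lambda>j. X (m j)))) = (\<Prod>j<s. real (card (X (m j))))"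
    by (simp add: card_PiE)
  also have "\<dots> \<le> (\<Prod>j<s. 2 * A / real (m j))"
    unfolding X_def using A m by (intro prod_mono conjI card_bounded_multiples_le(2)) auto
  finally show "real (card (Pi\<^sub>E {..<s} (\<lambda>j. X (m j)))) \<le> (2 * A) ^ s / (\<Prod>j<s. real (m j))"
    by (simp add: prod_dividef)
qed

text \<open>Each vector of \<open>S\<close> lies in a box \<open>Y i j d\<close> with d > G, in
  which d divides two coordinates or d^2 divides one. Such a box has at most
  \<open>(2 * A)^s / d^2\<close> elements, so the union bound over d and the \<open>s * s\<close>
  index pairs gives the decay 1/G.\<close>

lemma card_exceptional_le:
  fixes A G :: real and s :: nat
  assumes A: "A \<ge> 0" and G: "G > 0"
  defines "S \<equiv> {a \<in> {..<s} \<rightarrow>\<^sub>E {x::int. x \<noteq> 0}. (\<forall>j<s. real_of_int \<bar>a j\<bar> \<le> A) \<and>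
     ((\<exists>i<s. \<exists>j<s. i \<noteq> j \<and> real_of_int (gcd (a i) (a j)) > G) \<or>
      (\<exists>j<s. real_of_int (square_part (a j)) > G))}"
  shows "finite S" and "real (card S) \<le> 2 * real (s * s) * (2 * A) ^ s / G"
proof -
  define X where "X d = {x::int. x \<noteq> 0 \<and> real_of_int \<bar>x\<bar> \<le> A \<and> int d dvd x}" for d :: nat
  define M where "M = nat \<lfloor>A\<rfloor>"
  define \<D> where "\<D> = {d::nat. G < real d \<and> d \<le> M}"
  have f\<D>: "finite \<D>" unfolding \<D>_def by simp
  have \<D>0: "d > 0" if "d \<in> \<D>" for d using that G unfolding \<D>_def by auto
  \<comment> \<open>The otherwise idle diagonal \<open>i = j\<close> encodes the square part
    condition. In both cases the prescribed moduli multiply to d^2.\<close>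
  define mm where "mm i j d l = (if i = j then (if l = j then d\<^sup>2 else 1)
       else (if l = i \<or> l = j then d else 1))" for i j d l :: nat
  define Y where "Y i j d = Pi\<^sub>E {..<s} (\<lambda>l. X (mm i j d l))" for i j d
  have prod_mm: "(\<Prod>l<s. real (mm i j d l)) = real d ^ 2" if "i < s" "j < s" for i j d
  proof (cases "i = j")
    case True
    then have "(\<Prod>l<s. real (mm i j d l)) = (\<Prod>l<s. if l = j then real d ^ 2 else 1)"
      by (intro prod.cong) (auto simp: mm_def)
    then show ?thesis using that by (simp add: prod.delta)
  next
    case False
    have "(\<Prod>l<s. real (mm i j d l)) = (\<Prod>l\<in>{i, j}. real (mm i j d l))"
      using that False by (intro prod.mono_neutral_right) (auto simp: mm_def)
    also have "\<dots> = real d ^ 2" using False by (simp add: mm_def power2_eq_square)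
    finally show ?thesis .
  qed
  have Y: "finite (Y i j d)" "real (card (Y i j d)) \<le> (2 * A) ^ s * (1 / real d ^ 2)"
    if "i < s" "j < s" "d \<in> \<D>" for i j d
  proof -
    have "mm i j d l > 0" for l using \<D>0[OF that(3)] by (simp add: mm_def)
    then show "finite (Y i j d)" "real (card (Y i j d)) \<le> (2 * A) ^ s * (1 / real d ^ 2)"
      using card_box_multiples_le[OF A, of s "mm i j d"] prod_mm[OF that(1,2), of d]
      unfolding Y_def X_def by simp_all
  qed
  \<comment> \<open>A divisor of a non-zero entry is at most \<open>A\<close>, which confines d to a
    finite range.\<close>
  have in\<D>: "nat d \<in> \<D>" if "real_of_int d > G" "d dvd x" "x \<noteq> 0" "real_of_int \<bar>x\<bar> \<le> A" for d x :: int
  proof -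
    have "\<bar>d\<bar> \<le> \<bar>x\<bar>" using that by (intro dvd_imp_le_int) auto
    then have "real_of_int d \<le> A" using that(4) by linarith
    then show ?thesis using that(1) G unfolding \<D>_def M_def by (auto simp: le_floor_iff nat_mono)
  qed
  have sub: "S \<subseteq> (\<Union>i<s. \<Union>j<s. \<Union>d\<in>\<D>. Y i j d)"
  proof
    fix a assume aS: "a \<in> S"
    then have a: "a \<in> {..<s} \<rightarrow>\<^sub>E {x::int. x \<noteq> 0}" "\<And>j. j < s \<Longrightarrow> a j \<noteq> 0"
      "\<And>j. j < s \<Longrightarrow> real_of_int \<bar>a j\<bar> \<le> A" unfolding S_def by auto
    have inY: "a \<in> Y i j d" if "\<And>l. l < s \<Longrightarrow> int (mm i j d l) dvd a l" for i j d
      unfolding Y_def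
    proof (rule PiE_I)
      fix l assume "l \<in> {..<s}"
      then show "a l \<in> X (mm i j d l)" using a that unfolding X_def by simp
    next
      fix l assume "l \<notin> {..<s}"
      then show "a l = undefined" using a(1) by (rule PiE_arb[rotated])
    qed
    consider i j where "i < s" "j < s" "i \<noteq> j" "real_of_int (gcd (a i) (a j)) > G"
      | j where "j < s" "real_of_int (square_part (a j)) > G"
      using aS unfolding S_def by blast
    then show "a \<in> (\<Union>i<s. \<Union>j<s. \<Union>d\<in>\<D>. Y i j d)"
    proof cases
      case 1
      have "nat (gcd (a i) (a j)) \<in> \<D>"
        using in\<D>[OF 1(4), of "a i"] 1 a by simp
      moreover have "a \<in> Y i j (nat (gcd (a i) (a j)))"
        by (rule inY) (use 1(3) in \<open>auto simp: mm_def\<close>)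
      ultimately show ?thesis using 1 by blast
    next
      case 2
      have "square_part (a j) dvd a j"
        by (metis dvd_mult2 dvd_refl dvd_trans power2_eq_square square_part_square_dvd)
      then have "nat (square_part (a j)) \<in> \<D>"
        using in\<D>[OF 2(2), of "a j"] 2 a by simp
      moreover have "square_part (a j) > 0" using 2(2) G by linarith
      then have "a \<in> Y j j (nat (square_part (a j)))"
        by (intro inY) (auto simp: mm_def)
      ultimately show ?thesis using 2 by blast
    qed
  qed
  have fin: "finite (\<Union>i<s. \<Union>j<s. \<Union>d\<in>\<D>. Y i j d)"
    using f\<D> Y by auto
  show "finite S" using sub fin by (rule finite_subset)
  have "card S \<le> card (\<Union>i<s. \<Union>j<s. \<Union>d\<in>\<D>. Y i j d)"
    by (rule card_mono[OF fin sub])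
  also have "\<dots> \<le> (\<Sum>i<s. card (\<Union>j<s. \<Union>d\<in>\<D>. Y i j d))"
    by (rule card_UN_le) simp
  also have "\<dots> \<le> (\<Sum>i<s. \<Sum>j<s. card (\<Union>d\<in>\<D>. Y i j d))"
    by (intro sum_mono card_UN_le) simp
  also have "\<dots> \<le> (\<Sum>i<s. \<Sum>j<s. \<Sum>d\<in>\<D>. card (Y i j d))"
    by (intro sum_mono card_UN_le f\<D>)
  finally have "real (card S) \<le> real (\<Sum>i<s. \<Sum>j<s. \<Sum>d\<in>\<D>. card (Y i j d))"
    by (rule of_nat_mono)
  also have "\<dots> = (\<Sum>i<s. \<Sum>j<s. \<Sum>d\<in>\<D>. real (card (Y i j d)))" by simp
  also have "\<dots> \<le> (\<Sum>i<s. \<Sum>j<s. \<Sum>d\<in>\<D>. (2 * A) ^ s * (1 / real d ^ 2))"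
    by (intro sum_mono Y) auto
  also have "\<dots> = real (s * s) * ((2 * A) ^ s * (\<Sum>d\<in>\<D>. 1 / real d ^ 2))"
    unfolding sum_distrib_left[symmetric] by simp
  also have "\<dots> \<le> real (s * s) * ((2 * A) ^ s * (2 / G))"
    unfolding \<D>_def using A G by (intro mult_left_mono sum_inverse_squares_tail_le) auto
  also have "\<dots> = 2 * real (s * s) * (2 * A) ^ s / G" by simp
  finally show "real (card S) \<le> 2 * real (s * s) * (2 * A) ^ s / G" .
qed

theorem theorem1p2:
  fixes k s :: nat and \<eta> :: real
  assumes "k \<ge> 3" and "s \<ge> k + 3" and "\<eta> > 0"
  shows "\<exists>\<gamma>>0. \<exists>C. \<forall>A::real. A \<ge> 1 \<longrightarrow>
    real (card {a \<in> {..<s} \<rightarrow>\<^sub>E {x::int. x \<noteq> 0}.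
                 (\<forall>j<s. real_of_int \<bar>a j\<bar> \<le> A) \<and>
                 0 < sing_series k s a \<and> sing_series k s a < A powr (- \<eta>)})
      \<le> C * A powr (real s - \<gamma>)"
proof -
  have "\<exists>c>0. \<exists>K>0. \<forall>a G. (\<forall>j<s. a j \<noteq> 0) \<longrightarrow> sing_series k s a \<noteq> 0
     \<longrightarrow> (\<forall>i<s. \<forall>j<s. i \<noteq> j \<longrightarrow> real_of_int (gcd (a i) (a j)) \<le> G)
     \<longrightarrow> (\<forall>j<s. real_of_int (square_part (a j)) \<le> G)
     \<longrightarrow> 1 / (c * G ^ K) \<le> sing_series k s a"
    using assms by (intro sing_series_lower_bound) auto
  then obtain c :: real and K :: nat where c: "c > 0" and K: "K > 0"
    and low: "\<And>a G. \<lbrakk>\<forall>j<s. a j \<noteq> 0; sing_series k s a \<noteq> 0;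
        \<forall>i<s. \<forall>j<s. i \<noteq> j \<longrightarrow> real_of_int (gcd (a i) (a j)) \<le> G;
        \<forall>j<s. real_of_int (square_part (a j)) \<le> G\<rbrakk> \<Longrightarrow> 1 / (c * G ^ K) \<le> sing_series k s a"
    by blast
  \<comment> \<open>\<open>\<gamma>\<close> is the exponent of \<open>A\<close> in the threshold
    \<open>G\<close> below. \<open>C\<close> collects the constant of the counting bound and the
    factor \<open>c powr (1 / real K)\<close> coming from 1/G.\<close>
  define \<gamma> where "\<gamma> = \<eta> / real K"
  define C where "C = 2 * real (s * s) * 2 ^ s * c powr (1 / real K)"
  have "real (card {a \<in> {..<s} \<rightarrow>\<^sub>E {x::int. x \<noteq> 0}.
                 (\<forall>j<s. real_of_int \<bar>a j\<bar> \<le> A) \<and>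
                 0 < sing_series k s a \<and> sing_series k s a < A powr (- \<eta>)})
      \<le> C * A powr (real s - \<gamma>)" (is "real (card ?Z) \<le> _") if A: "A \<ge> 1" for A :: real
  proof -
    \<comment> \<open>\<open>G\<close> solves \<open>c * G^K = A powr \<eta>\<close>. If no gcd and
      no square part exceeded it, the singular series would be at least
      \<open>A powr (- \<eta>)\<close>, against the strict inequality in \<open>?Z\<close>.\<close>
    define G where "G = A powr \<gamma> / c powr (1 / real K)"
    have G: "G > 0" using A c by (simp add: G_def)
    have GK: "G ^ K = A powr \<eta> / c"
    proof -
      have "G ^ K = (A powr \<gamma>) ^ K / (c powr (1 / real K)) ^ K" by (simp add: G_def power_divide)
      also have "(A powr \<gamma>) ^ K = A powr \<eta>" using A K by (simp add: powr_power \<gamma>_def)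
      also have "(c powr (1 / real K)) ^ K = c" using c K by (simp add: powr_power)
      finally show ?thesis .
    qed
    let ?S = "{a \<in> {..<s} \<rightarrow>\<^sub>E {x::int. x \<noteq> 0}. (\<forall>j<s. real_of_int \<bar>a j\<bar> \<le> A) \<and>
     ((\<exists>i<s. \<exists>j<s. i \<noteq> j \<and> real_of_int (gcd (a i) (a j)) > G) \<or>
      (\<exists>j<s. real_of_int (square_part (a j)) > G))}"
    have "?Z \<subseteq> ?S"
    proof (rule subsetI, rule ccontr)
      fix a assume a: "a \<in> ?Z" and nS: "a \<notin> ?S"
      have "\<forall>j<s. a j \<noteq> 0" "sing_series k s a \<noteq> 0" using a by auto
      moreover have "\<forall>i<s. \<forall>j<s. i \<noteq> j \<longrightarrow> real_of_int (gcd (a i) (a j)) \<le> G"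
        "\<forall>j<s. real_of_int (square_part (a j)) \<le> G"
        using a nS unfolding mem_Collect_eq not_less[symmetric] by blast+
      ultimately have "1 / (c * G ^ K) \<le> sing_series k s a" by (rule low)
      also have "1 / (c * G ^ K) = A powr (- \<eta>)"
        unfolding GK using c by (simp add: powr_minus divide_inverse)
      finally show False using a by simp
    qed
    then have "card ?Z \<le> card ?S"
      using card_exceptional_le(1)[of A G s] A G by (intro card_mono) auto
    then have "real (card ?Z) \<le> real (card ?S)" by (rule of_nat_mono)
    also have "\<dots> \<le> 2 * real (s * s) * (2 * A) ^ s / G"
      using A G by (intro card_exceptional_le(2)) auto
    also have "\<dots> = C * (A powr real s / A powr \<gamma>)"
      using A unfolding G_def C_def by (simp add: power_mult_distrib powr_realpow)
    also have "\<dots> = C * A powr (real s - \<gamma>)" by (simp add: powr_diff)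
    finally show ?thesis .
  qed
  moreover have "\<gamma> > 0" using assms K by (simp add: \<gamma>_def)
  ultimately show ?thesis by blast
qed

end
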